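(* Let the function $f$ have continuous derivatives up to $(R+1)$th order on $[a,b]$. Let $(\chi(n))$ be a complex sequence with period $k$ and let $d(n)$ be the divisor function (the number of divisors of $n$). Then the following hold. (I) $$\sum_{a<n\le b}\chi(n)f(n)=\frac1k\sum_{l=1}^{k}\chi(l)\int_a^b f(u)\,du-\sum_{r=0}^{R}(-k)^r\left\{f^{(r)}(b)\sum_{n}{}'\,\tau(\chi,-n)\frac{e^{2\pi i n b/k}}{(2\pi i n)^{r+1}}-f^{(r)}(a)\sum_{n}{}'\,\tau(\chi,-n)\frac{e^{2\pi i n a/k}}{(2\pi i n)^{r+1}}\right\}+(-k)^R\sum_{n}{}'\,\frac{\tau(\chi,-n)}{(2\pi i n)^{R+1}}\int_a^b f^{(R+1)}(u)e^{2\pi i n u/k}\,du,$$ where $\tau(\chi,n)=\sum_{l=1}^{k}\chi(l)e^{2\pi i n l/k}$. (II) $$\sum_{a<n\le b}d(n)f(n)=\int_a^b f(u)\,du\left(\sum_{m\le b}\frac1m\right)+\sum_{r=0}^{R}(-1)^{r+1}\left\{f^{(r)}(b)\sum_{n}{}'\,\frac{1}{(2\pi i n)^{r+1}}\Big(\sum_{m\le b}m^r e^{2\pi i n b/m}\Big)-f^{(r)}(a)\sum_{n}{}'\,\frac{1}{(2\pi i n)^{r+1}}\Big(\sum_{m\le b}m^r e^{2\pi i n a/m}\Big)\right\}+(-1)^R\sum_{n}{}'\,\frac{1}{(2\pi i n)^{R+1}}\int_a^b f^{(R+1)}(u)\Big(\sum_{m\le b}m^R e^{2\pi i n u/m}\Big)du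 .$$ (III) $$\sum_{a<n\le b}\chi(n)d(n)f(n)=\frac1k\sum_{r_1=1}^{k}\sum_{r_2=1}^{k}\chi(r_1r_2)\Big(\sum_{\substack{m\le b\\ m\equiv r_1 (\mathrm{mod}\ k)}}\frac1m\int_a^b f(u)\,du\Big)$$ $$+\sum_{r=0}^{R}(-1)^{r+1}k^r\sum_{r_1=1}^{k}\sum_{r_2=1}^{k}\chi(r_1r_2)\left\{f^{(r)}(b)\sum_{n}{}'\,\frac{e^{-2\pi i n r_2/k}}{(2\pi i n)^{r+1}}\cdot\sum_{\substack{m\le b\\ m\equiv r_1 (\mathrm{mod}\ k)}}e^{2\pi i n b/mk}-f^{(r)}(a)\sum_{n}{}'\,\frac{e^{-2\pi i n r_2/k}}{(2\pi i n)^{r+1}}\cdot\sum_{\substack{m\le b\\ m\equiv r_1 (\mathrm{mod}\ k)}}e^{2\pi i n a/mk}\right\}$$ $$+(-k)^R\sum_{r_1=1}^{k}\sum_{r_2=1}^{k}\chi(r_1r_2)\sum_{n}{}'\,e^{-2\pi i n r_2/k}\int_a^b f^{(R+1)}(u)\Big(\sum_{\substack{m\le b\\ m\equiv r_1 (\mathrm{mod}\ k)}}e^{2\pi i n u/mk}\Big)du .$$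
   Context: $\sum_n$ denotes summation over all integers $n$ in the sense $\lim_{N\to\infty}\sum_{|n|\le N}$, and $\sum_n{}'$ denotes the same with the term $n=0$ excluded. The sums $\sum_{m\le b}$ run over positive integers $m\le b$, and the sums $\sum_{a<n\le b}$ run over integers $n$. In the exponents, $b/mk$, $a/mk$, $u/mk$ mean $b/(mk)$, $a/(mk)$, $u/(mk)$. $f^{(r)}$ is the $r$th derivative of $f$, with $f^{(0)}=f$.
   Formalization: Printed formulas are false. Proved: (I)-(III) with opposite sign on all terms after the leading one; in (III) factors m^r, m^R and 1/(2πin)^{R+1} inserted; a term ½(summand at b − summand at a) added for integer endpoints; a<b, and a≥0 in (II),(III). *)

theory Defs
  imports "HOL-Analysis.Analysis" "HOL-Number_Theory.Cong"
begin

text \<open>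
  Iterated derivatives relative to a set, so that the derivatives at the endpoints of a
  compact interval are one-sided.
\<close>

primrec nth_deriv_within :: "real set \<Rightarrow> nat \<Rightarrow> (real \<Rightarrow> complex) \<Rightarrow> real \<Rightarrow> complex" where
  "nth_deriv_within S 0 f = f"
| "nth_deriv_within S (Suc r) f =
     (\<lambda>x. vector_derivative (nth_deriv_within S r f) (at x within S))"

definition cont_derivs_on :: "nat \<Rightarrow> real set \<Rightarrow> (real \<Rightarrow> complex) \<Rightarrow> bool" where
  "cont_derivs_on q S f \<longleftrightarrow>
     (\<forall>r<q. \<forall>x\<in>S. nth_deriv_within S r f differentiable (at x within S)) \<and>
     (\<forall>r\<le>q. continuous_on S (nth_deriv_within S r f))"

text \<open>
  Sums over all nonzero integers are limits of symmetric partial sums; they need not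
  converge absolutely.
\<close>

definition sym_partial :: "(int \<Rightarrow> complex) \<Rightarrow> nat \<Rightarrow> complex" where
  "sym_partial g N = (\<Sum>n | n \<noteq> 0 \<and> \<bar>n\<bar> \<le> int N. g n)"

definition sym_convergent :: "(int \<Rightarrow> complex) \<Rightarrow> bool" where
  "sym_convergent g \<longleftrightarrow> convergent (sym_partial g)"

definition sym_sum :: "(int \<Rightarrow> complex) \<Rightarrow> complex" where
  "sym_sum g = lim (sym_partial g)"

definition tau :: "nat \<Rightarrow> (int \<Rightarrow> complex) \<Rightarrow> int \<Rightarrow> complex" where
  "tau k chi n = (\<Sum>l=1..k. chi (int l) * cis (2 * pi * of_int n * of_nat l / of_nat k))"

definition divisor_fun :: "int \<Rightarrow> nat" where
  "divisor_fun n = card {m::nat. 0 < m \<and> int m dvd n}"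

text \<open>
  The multiplicity with which an integer \<open>n \<ge> 0\<close> arises as a product with first
  factor \<open>m \<le> b\<close>: this is the number of divisors if \<open>1 \<le> n \<le> b\<close>, but it also
  makes sense at the endpoint \<open>n = 0\<close>, where the divisor function does not.
\<close>

definition divisors_upto :: "real \<Rightarrow> int \<Rightarrow> nat" where
  "divisors_upto b n = card {m::nat. 1 \<le> m \<and> real m \<le> b \<and> int m dvd n}"

lemma divisors_upto_eq_divisor_fun:
  assumes "1 \<le> n" "real_of_int n \<le> b"
  shows "divisors_upto b n = divisor_fun n"
proof -
  have "real m \<le> b" if "int m dvd n" for m
  proof -
    have "int m \<le> n" using that assms(1) by (intro zdvd_imp_le) auto
    hence "real m \<le> real_of_int n" by linarith
    thus ?thesis using assms(2) by linarith
  qed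
  hence "{m::nat. 1 \<le> m \<and> real m \<le> b \<and> int m dvd n} = {m::nat. 0 < m \<and> int m dvd n}"
    by auto
  thus ?thesis unfolding divisors_upto_def divisor_fun_def by simp
qed

lemma divisors_upto_zero: "divisors_upto b 0 = nat \<lfloor>b\<rfloor>"
proof -
  have "{m::nat. 1 \<le> m \<and> real m \<le> b \<and> int m dvd 0} = {1..nat \<lfloor>b\<rfloor>}"
    by (auto simp: le_nat_iff le_floor_iff) linarith+
  thus ?thesis unfolding divisors_upto_def by simp
qed

text \<open>
  The symmetric series with terms \<open>cis (2 * pi * n * x) / (2 * pi * \<i> * n)\<close>, \<open>n \<noteq> 0\<close>, has
  the value \<open>1 / 2 - frac x\<close> for nonintegral \<open>x\<close>, but \<open>0\<close> (the mean of the one-sided limits) at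
  integers, so a summand sitting at an integral endpoint is counted by it with weight one half.
  The following term accounts for the difference from the sum over
  \<open>a < n \<le> b\<close>; it vanishes when neither endpoint is an integer.
\<close>

definition end_value :: "(int \<Rightarrow> complex) \<Rightarrow> real \<Rightarrow> complex" where
  "end_value g x = (if x \<in> \<int> then g \<lfloor>x\<rfloor> else 0)"

definition end_correction :: "real \<Rightarrow> real \<Rightarrow> (int \<Rightarrow> complex) \<Rightarrow> complex" where
  "end_correction a b g = (end_value g b - end_value g a) / 2"

lemma end_correction_eq_0:
  assumes "a \<notin> \<int>" "b \<notin> \<int>"
  shows "end_correction a b g = 0"
  using assms by (simp add: end_correction_def end_value_def)

end

theory Submission
  imports Defs "HOL-Real_Asymp.Real_Asymp"
begin

text \<open>
  All three formulas are Euler--Maclaurin summation along arithmetic progressions. The boundary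
  functions are the symmetric Fourier series with terms
  \<open>cis (2 * pi * n * y) / (2 * pi * \<i> * n) ^ s\<close>; for \<open>s = 1\<close> this is the sawtooth, which
  jumps by one at integers, so integration by parts against it counts the points of a progression
  \<open>l + q * \<int>\<close> in \<open>(a, b]\<close>. The partial sums of the sawtooth series are uniformly bounded, hence it
  may be integrated termwise against \<open>f'\<close>, and further integrations by parts are exact for each
  frequency \<open>n\<close>, so no convergence question arises beyond the first step. The sums in the theorem
  are finite weighted combinations of progressions: residues \<open>n \<equiv> l\<close> modulo \<open>k\<close> with weight
  \<open>chi l\<close> in (I), multiples of \<open>m\<close> for \<open>m \<le> b\<close> in (II), and \<open>m * j\<close> with \<open>m \<le> b\<close>, \<open>m \<equiv> r1\<close>,
  \<open>j \<equiv> r2\<close> in (III).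
\<close>

section \<open>The sawtooth Fourier series\<close>

text \<open>The value 0 at integers is the limit of the sine series there, since all its terms
  vanish.\<close>

definition sawtooth :: "real \<Rightarrow> real" where
  "sawtooth y = (if y \<in> \<int> then 0 else 1 / 2 - frac y)"

definition saw_partial :: "nat \<Rightarrow> real \<Rightarrow> real" where
  "saw_partial N y = (\<Sum>n=1..N. sin (2 * pi * real n * y) / (pi * real n))"

text \<open>The product \<open>2 * cos (2 * n * z) * sin z\<close> is a difference of sines of
  consecutive odd multiples of \<open>z\<close>, so the sum telescopes.\<close>

lemma Dirichlet_kernel:
  "(1 + 2 * (\<Sum>n=1..N. cos (2 * real n * z))) * sin z = sin ((2 * real N + 1) * z)"
proof (induction N)
  case (Suc N)
  have "2 * cos (2 * real (Suc N) * z) * sin z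
      = sin ((2 * real (Suc N) + 1) * z) - sin ((2 * real N + 1) * z)"
    using sin_add[of "2 * real (Suc N) * z" z] sin_diff[of "2 * real (Suc N) * z" z]
    by (simp add: algebra_simps)
  then show ?case using Suc by (simp add: algebra_simps)
qed simp

text \<open>A crude form of Jordan's inequality, from the cubic Taylor bound and
  \<open>z ^ 2 \<le> 3\<close>. It keeps the denominator in the error estimate away from 0.\<close>

lemma half_le_sin:
  fixes z :: real
  assumes "0 \<le> z" "z \<le> pi / 2"
  shows "z / 2 \<le> sin z"
proof -
  have "pi \<le> 16 / 5" by (rule order_trans[OF pi_approx(2)]) simp
  then have "z \<le> 8 / 5" using assms by linarith
  then have "z ^ 2 \<le> (8 / 5) ^ 2" using assms by (intro power_mono) auto
  then have "z * z ^ 2 \<le> z * 3" using assms by (intro mult_left_mono) (auto simp: power2_eq_square)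
  moreover have "\<bar>sin z - z\<bar> \<le> z ^ 3 / 6"
    using Maclaurin_sin_bound[of z 3] assms
    by (simp add: eval_nat_numeral sin_coeff_def fact_numeral field_simps)
  ultimately have "\<bar>sin z - z\<bar> \<le> z / 2" by (simp add: eval_nat_numeral)
  then show ?thesis by linarith
qed

text \<open>This explicit estimate serves twice: for fixed \<open>y\<close> it gives convergence,
  and where \<open>(2 * N + 1) * y > 1\<close> it gives a bound uniform in \<open>N\<close> and
  \<open>y\<close>.\<close>

lemma saw_partial_error:
  assumes "0 < y" "y \<le> 1 / 2"
  shows "\<bar>saw_partial N y - (1 / 2 - y)\<bar> \<le> 2 / ((2 * real N + 1) * pi * sin (pi * y))"
proof -
  define M where "M = 2 * real N + 1"
  have M: "M > 0" by (simp add: M_def)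
  \<comment> \<open>\<open>G\<close> is the error corrected by the boundary term of one integration by parts of the Dirichlet
    kernel; then \<open>\<bar>G'\<bar> \<le> - H'\<close>, so \<open>\<bar>G\<bar> \<le> H\<close> because \<open>G\<close> vanishes at \<open>1 / 2\<close>.\<close>
  define H where "H = (\<lambda>u. 1 / (M * pi * sin (pi * u)))"
  define G where "G = (\<lambda>u. saw_partial N u - (1 / 2 - u) + cos (M * pi * u) * H u)"
  define H' where "H' = (\<lambda>u. - cos (pi * u) / (M * (sin (pi * u))\<^sup>2))"
  have sin_pos: "sin (pi * u) > 0" if "u \<in> {y..1/2}" for u
  proof (rule sin_gt_zero)
    show "0 < pi * u" using that assms by auto
    have "pi * u \<le> pi * (1/2)" using that by (intro mult_left_mono) auto
    then show "pi * u < pi" using pi_gt_zero by linarith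
  qed
  have cos_nn: "cos (pi * u) \<ge> 0" if "u \<in> {y..1/2}" for u
  proof (rule cos_ge_zero)
    have "0 \<le> pi * u" using that assms by auto
    then show "- (pi / 2) \<le> pi * u" using pi_gt_zero by linarith
    have "pi * u \<le> pi * (1/2)" using that by (intro mult_left_mono) auto
    then show "pi * u \<le> pi / 2" by simp
  qed
  have dH: "(H has_real_derivative H' u) (at u)" if "u \<in> {y..1/2}" for u
    unfolding H_def H'_def using sin_pos[OF that] M
    by (auto intro!: derivative_eq_intros simp: field_simps power2_eq_square)
  have dS: "(saw_partial N has_real_derivative (\<Sum>n=1..N. 2 * cos (2 * real n * (pi * u)))) (at u)" for u
    unfolding saw_partial_def
    by (auto intro!: derivative_eq_intros sum.cong simp: field_simps)
  have dG: "(G has_real_derivative H' u * cos (M * pi * u)) (at u)" if "u \<in> {y..1/2}" for u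
  proof -
    have "1 + 2 * (\<Sum>n=1..N. cos (2 * real n * (pi * u))) = sin (M * pi * u) / sin (pi * u)"
      using Dirichlet_kernel[of "pi * u" N] sin_pos[OF that]
      by (simp add: M_def field_simps)
    \<comment> \<open>The Dirichlet kernel is the derivative of
      \<open>saw_partial N u - (1 / 2 - u)\<close>. It cancels the derivative of the cosine factor
      in \<open>G\<close>, so only the term with \<open>H'\<close> survives.\<close>
    then have *: "(\<Sum>n=1..N. 2 * cos (2 * real n * (pi * u))) + 1 = M * pi * sin (M * pi * u) * H u"
      using M by (simp add: H_def sum_distrib_left)
    have "(G has_real_derivative ((\<Sum>n=1..N. 2 * cos (2 * real n * (pi * u))) + 1
        + (H' u * cos (M * pi * u) - M * pi * sin (M * pi * u) * H u))) (at u)"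
      unfolding G_def
      by (auto intro!: derivative_eq_intros dS dH[OF that] simp: field_simps)
    then show ?thesis unfolding * by simp
  qed
  have H'_le: "H' u \<le> 0" if "u \<in> {y..1/2}" for u
    using cos_nn[OF that] M by (simp add: H'_def divide_nonneg_pos)
  \<comment> \<open>At \<open>1 / 2\<close> the sines are taken at integer multiples of
    \<open>pi\<close>, and the cosine vanishes because \<open>M\<close> is odd.\<close>
  have Gend: "G (1/2) = 0"
  proof -
    have "saw_partial N (1/2) = 0"
      unfolding saw_partial_def
      by (rule sum.neutral) (auto simp: mult.commute[of pi])
    moreover have "cos (M * pi * (1/2)) = 0"
    proof -
      have "cos (M * pi * (1/2)) = cos (real N * pi + pi / 2)"
        by (simp add: M_def field_simps)
      also have "\<dots> = 0" by (simp add: cos_add)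
      finally show ?thesis .
    qed
    ultimately show ?thesis by (simp add: G_def)
  qed
  have Hpos: "H u > 0" if "u \<in> {y..1/2}" for u
    using sin_pos[OF that] M by (simp add: H_def)
  have "(\<lambda>u. H u - G u) (1/2) \<le> (\<lambda>u. H u - G u) y"
  proof (rule DERIV_nonpos_imp_nonincreasing[OF assms(2)])
    fix u assume u: "y \<le> u" "u \<le> 1/2"
    have "H' u * 1 \<le> H' u * cos (M * pi * u)"
      using u by (intro mult_left_mono_neg H'_le) auto
    moreover have "((\<lambda>u. H u - G u) has_real_derivative H' u - H' u * cos (M * pi * u)) (at u)"
      using u by (intro DERIV_diff dH dG) auto
    ultimately show "\<exists>d. ((\<lambda>u. H u - G u) has_real_derivative d) (at u) \<and> d \<le> 0"
      by (metis diff_le_0_iff_le mult.right_neutral)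
  qed
  moreover have "(\<lambda>u. H u + G u) (1/2) \<le> (\<lambda>u. H u + G u) y"
  proof (rule DERIV_nonpos_imp_nonincreasing[OF assms(2)])
    fix u assume u: "y \<le> u" "u \<le> 1/2"
    have "H' u * cos (M * pi * u) \<le> H' u * (-1)"
      using u by (intro mult_left_mono_neg H'_le) auto
    then have "H' u + H' u * cos (M * pi * u) \<le> 0" by simp
    moreover have "((\<lambda>u. H u + G u) has_real_derivative H' u + H' u * cos (M * pi * u)) (at u)"
      using u by (intro DERIV_add dH dG) auto
    ultimately show "\<exists>d. ((\<lambda>u. H u + G u) has_real_derivative d) (at u) \<and> d \<le> 0"
      by blast
  qed
  ultimately have "\<bar>G y\<bar> \<le> H y"
    using Gend Hpos[of "1/2"] assms by auto
  moreover have "\<bar>cos (M * pi * y) * H y\<bar> \<le> 1 * H y"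
    unfolding abs_mult using Hpos[of y] assms by (intro mult_mono) auto
  ultimately have "\<bar>saw_partial N y - (1 / 2 - y)\<bar> \<le> 2 * H y"
    unfolding G_def by linarith
  then show ?thesis by (simp add: H_def M_def)
qed

lemma saw_partial_add_int: "saw_partial N (y + of_int j) = saw_partial N y"
proof -
  have "sin (2 * pi * real n * (y + of_int j)) = sin (2 * pi * real n * y)" for n
  proof -
    have "2 * pi * real n * (y + of_int j) = 2 * pi * real n * y + 2 * pi * of_int (int n * j)"
      by (simp add: algebra_simps)
    then show ?thesis by (simp only: sin_add sin_int_2pin cos_int_2pin mult_zero_right mult_1_right add_0_right)
  qed
  then show ?thesis by (simp add: saw_partial_def)
qed

lemma saw_partial_frac: "saw_partial N (frac y) = saw_partial N y"
  using saw_partial_add_int[of N y "- \<lfloor>y\<rfloor>"] by (simp add: frac_def)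

lemma saw_partial_minus: "saw_partial N (- y) = - saw_partial N y"
  by (simp add: saw_partial_def sum_negf)

lemma saw_partial_one_minus: "saw_partial N (1 - y) = - saw_partial N y"
  using saw_partial_add_int[of N "- y" 1] by (simp add: saw_partial_minus)

text \<open>The uniform bound that permits dominated convergence. By periodicity and oddness it
  suffices to treat \<open>0 < y \<le> 1/2\<close>. For \<open>(2 * N + 1) * y \<le> 1\<close> each
  term is at most \<open>2 * y\<close>; otherwise the limit and the error each contribute at most
  1/2.\<close>

lemma abs_saw_partial_le: "\<bar>saw_partial N y\<bar> \<le> 1"
proof -
  have small: "\<bar>saw_partial N y\<bar> \<le> 1" if "0 < y" "y \<le> 1/2" for y
  proof (cases "(2 * real N + 1) * y \<le> 1")
    case True
    have "\<bar>saw_partial N y\<bar> \<le> (\<Sum>n=1..N. \<bar>sin (2 * pi * real n * y) / (pi * real n)\<bar>)"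
      unfolding saw_partial_def by (rule sum_abs)
    also have "\<dots> \<le> (\<Sum>n=1..N. 2 * y)"
    proof (rule sum_mono)
      fix n assume n: "n \<in> {1..N}"
      have "\<bar>sin (2 * pi * real n * y)\<bar> \<le> \<bar>2 * pi * real n * y\<bar>" by (rule abs_sin_x_le_abs_x)
      then show "\<bar>sin (2 * pi * real n * y) / (pi * real n)\<bar> \<le> 2 * y"
        using n that by (simp add: abs_mult field_simps)
    qed
    also have "\<dots> = 2 * real N * y" by simp
    also have "\<dots> \<le> 1" using True that by (simp add: algebra_simps)
    finally show ?thesis .
  next
    case False
    define M where "M = 2 * real N + 1"
    have "pi * y / 2 \<le> sin (pi * y)"
      using that by (intro half_le_sin) (auto simp: field_simps)
    then have "M * pi * (pi * y / 2) \<le> M * pi * sin (pi * y)"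
      by (intro mult_left_mono) (auto simp: M_def)
    \<comment> \<open>Since \<open>pi * pi \<ge> 9\<close> and \<open>M * y > 1\<close>, the product
      is even at least 9/2; the value 4 makes the error at most 1/2.\<close>
    moreover have "M * pi * (pi * y / 2) \<ge> 4"
    proof -
      have "3 * 3 \<le> pi * pi" using pi_gt3 by (intro mult_mono) auto
      then have "9 * 1 \<le> (pi * pi) * (M * y)"
        using False by (intro mult_mono) (auto simp: M_def)
      then show ?thesis by (simp add: algebra_simps)
    qed
    ultimately have "2 / (M * pi * sin (pi * y)) \<le> 2 / 4"
      by (intro divide_left_mono) auto
    then show ?thesis using saw_partial_error[OF that, of N] that unfolding M_def by linarith
  qed
  define z where "z = frac y"
  have z: "0 \<le> z" "z < 1" by (simp_all add: z_def frac_lt_1)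
  have "\<bar>saw_partial N z\<bar> \<le> 1"
  proof -
    consider "z = 0" | "0 < z" "z \<le> 1/2" | "1/2 < z" using z by linarith
    then show ?thesis
    proof cases
      case 1 then show ?thesis by (simp add: saw_partial_def)
    next
      case 2 then show ?thesis by (rule small)
    next
      case 3
      have "\<bar>saw_partial N (1 - z)\<bar> \<le> 1" using 3 z by (intro small) auto
      then show ?thesis by (simp add: saw_partial_one_minus)
    qed
  qed
  then show ?thesis by (simp add: z_def saw_partial_frac)
qed

lemma saw_partial_tendsto: "(\<lambda>N. saw_partial N y) \<longlonglongrightarrow> sawtooth y"
proof -
  have half: "(\<lambda>N. saw_partial N y) \<longlonglongrightarrow> 1 / 2 - y" if "0 < y" "y \<le> 1/2" for y
  proof (rule Lim_transform2)
    show "(\<lambda>N. 1 / 2 - y) \<longlonglongrightarrow> 1 / 2 - y" by simp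
    have lim: "(\<lambda>N. 2 / ((2 * real N + 1) * (pi * sin (pi * y)))) \<longlonglongrightarrow> 0"
    proof -
      have "0 < sin (pi * y)"
      proof (rule sin_gt_zero)
        show "0 < pi * y" using that by simp
        have "pi * y \<le> pi * (1/2)" using that by (intro mult_left_mono) auto
        then show "pi * y < pi" using pi_gt_zero by linarith
      qed
      then show ?thesis by real_asymp
    qed
    show "(\<lambda>N. 1 / 2 - y - saw_partial N y) \<longlonglongrightarrow> 0"
      using saw_partial_error[OF that]
      by (intro Lim_null_comparison[OF always_eventually lim])
        (auto simp: abs_minus_commute mult.assoc)
  qed
  define z where "z = frac y"
  have z: "0 \<le> z" "z < 1" by (simp_all add: z_def frac_lt_1)
  have "(\<lambda>N. saw_partial N z) \<longlonglongrightarrow> sawtooth y"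
  proof (cases "z = 0")
    case True
    then have "y \<in> \<int>" by (simp add: z_def frac_eq_0_iff)
    then show ?thesis using True by (simp add: saw_partial_def sawtooth_def)
  next
    case False
    then have y: "sawtooth y = 1 / 2 - z" by (simp add: sawtooth_def z_def frac_eq_0_iff)
    show ?thesis
    proof (cases "z \<le> 1/2")
      case True
      then show ?thesis using half[of z] z False y by simp
    next
      case F: False
      have "(\<lambda>N. - saw_partial N (1 - z)) \<longlonglongrightarrow> - (1 / 2 - (1 - z))"
        using F z by (intro tendsto_minus half) auto
      then show ?thesis by (simp add: saw_partial_one_minus y)
    qed
  qed
  then show ?thesis by (simp add: z_def saw_partial_frac)
qed

text \<open>Pairing \<open>n\<close> with \<open>- n\<close> turns symmetric summation into an
  ordinary series over the naturals.\<close>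

lemma sym_partial_eq_sum_nat:
  "sym_partial g N = (\<Sum>n=1..N. g (int n) + g (- int n))"
proof -
  have "{n. n \<noteq> 0 \<and> \<bar>n\<bar> \<le> int N} = int ` {1..N} \<union> (\<lambda>n. - int n) ` {1..N}"
  proof (intro equalityI subsetI)
    fix n assume n: "n \<in> {n. n \<noteq> 0 \<and> \<bar>n\<bar> \<le> int N}"
    then have "nat \<bar>n\<bar> \<in> {1..N}" "n = int (nat \<bar>n\<bar>) \<or> n = - int (nat \<bar>n\<bar>)" by auto
    then show "n \<in> int ` {1..N} \<union> (\<lambda>n. - int n) ` {1..N}" by blast
  qed auto
  then have "sym_partial g N = sum g (int ` {1..N}) + sum g ((\<lambda>n. - int n) ` {1..N})"
    unfolding sym_partial_def by (simp only:) (rule sum.union_disjoint, auto)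
  also have "\<dots> = (\<Sum>n=1..N. g (int n)) + (\<Sum>n=1..N. g (- int n))"
    by (simp add: sum.reindex inj_on_def)
  finally show ?thesis by (simp add: sum.distrib)
qed

text \<open>In each pair \<open>n\<close>, \<open>- n\<close> the cosine parts cancel and the sine
  parts double.\<close>

lemma sym_partial_sawtooth:
  "sym_partial (\<lambda>n. cis (2 * pi * of_int n * y) / (2 * of_real pi * \<i> * of_int n)) N
    = of_real (saw_partial N y)"
proof -
  have "cis (2 * pi * of_int (int n) * y) / (2 * of_real pi * \<i> * of_int (int n))
      + cis (2 * pi * of_int (- int n) * y) / (2 * of_real pi * \<i> * of_int (- int n))
      = of_real (sin (2 * pi * real n * y) / (pi * real n))" for n
    by (cases "n = 0") (auto simp: complex_eq_iff Re_divide Im_divide field_simps power2_eq_square)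
  then show ?thesis
    unfolding sym_partial_eq_sum_nat saw_partial_def of_real_sum by (intro sum.cong) auto
qed

section \<open>Summation along an arithmetic progression\<close>

text \<open>The sawtooth in the rescaled variable has its exceptional value exactly at points of the
  progression; this matches it with \<open>end_correction\<close>.\<close>

lemma progression_point_iff:
  fixes x :: real and l :: int
  assumes "0 < (q :: nat)"
  shows "(x - of_int l) / of_nat q \<in> \<int> \<longleftrightarrow> x \<in> \<int> \<and> int q dvd \<lfloor>x\<rfloor> - l"
proof
  assume "(x - of_int l) / of_nat q \<in> \<int>"
  then obtain t :: int where "(x - of_int l) / of_nat q = of_int t" by (auto elim: Ints_cases)
  then have "x = of_int (l + int q * t)" using assms by (simp add: field_simps)
  then show "x \<in> \<int> \<and> int q dvd \<lfloor>x\<rfloor> - l" by (metis Ints_of_int add_diff_cancel_left' dvd_triv_left floor_of_int)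
next
  assume *: "x \<in> \<int> \<and> int q dvd \<lfloor>x\<rfloor> - l"
  then obtain t where t: "\<lfloor>x\<rfloor> = l + int q * t" by (metis add.commute diff_add_cancel dvdE)
  have "x = of_int \<lfloor>x\<rfloor>" using * by (auto elim: Ints_cases)
  then have "x = of_int (l + int q * t)" by (simp only: t)
  then have "(x - of_int l) / of_nat q = of_int t" using assms by (simp add: field_simps)
  then show "(x - of_int l) / of_nat q \<in> \<int>" by simp
qed

text \<open>Derivatives are taken within the interval, hence one-sided at the endpoints, as
  \<open>nth_deriv_within\<close> provides them.\<close>

lemma integral_by_parts_within:
  fixes f g f' g' :: "real \<Rightarrow> complex"
  assumes "a \<le> b"
    and "\<And>x. x \<in> {a..b} \<Longrightarrow> (f has_vector_derivative f' x) (at x within {a..b})"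
    and "\<And>x. x \<in> {a..b} \<Longrightarrow> (g has_vector_derivative g' x) (at x within {a..b})"
    and f': "continuous_on {a..b} f'" and g': "continuous_on {a..b} g'"
  shows "integral {a..b} (\<lambda>u. f' u * g u) = f b * g b - f a * g a - integral {a..b} (\<lambda>u. f u * g' u)"
proof -
  have f: "continuous_on {a..b} f" and g: "continuous_on {a..b} g"
    using assms(2,3) by (blast intro: continuous_on_vector_derivative)+
  have "((\<lambda>u. f u * g' u + f' u * g u) has_integral f b * g b - f a * g a) {a..b}"
    using assms by (intro fundamental_theorem_of_calculus has_vector_derivative_mult) auto
  moreover have "((\<lambda>u. f u * g' u + f' u * g u) has_integral
      integral {a..b} (\<lambda>u. f u * g' u) + integral {a..b} (\<lambda>u. f' u * g u)) {a..b}"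
    using f g f' g'
    by (intro has_integral_add integrable_integral integrable_continuous_real continuous_intros)
  ultimately have "f b * g b - f a * g a =
      integral {a..b} (\<lambda>u. f u * g' u) + integral {a..b} (\<lambda>u. f' u * g u)"
    by (rule has_integral_unique)
  then show ?thesis by (simp add: algebra_simps)
qed

text \<open>On \<open>[a, b]\<close> the sawtooth is, up to a null set, an affine function plus one
  unit step at each progression point. Integrating \<open>f'\<close> against the affine part
  produces the integral of \<open>f\<close>, and against each step it produces \<open>f b\<close>
  minus the value of \<open>f\<close> at that point. The half weights at integral endpoints go into
  \<open>end_correction\<close>.\<close>

lemma progression_sum_sawtooth:
  fixes f f' :: "real \<Rightarrow> complex" and q :: nat and l :: int
  assumes ab: "a \<le> b" and q: "0 < q"
    and deriv: "\<And>x. x \<in> {a..b} \<Longrightarrow> (f has_vector_derivative f' x) (at x within {a..b})"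
    and f': "continuous_on {a..b} f'"
  shows "(\<Sum>n | a < of_int n \<and> of_int n \<le> b \<and> int q dvd n - l. f (of_int n)) =
      1 / of_nat q * integral {a..b} f
      + f b * of_real (sawtooth ((b - of_int l) / of_nat q))
      - f a * of_real (sawtooth ((a - of_int l) / of_nat q))
      - integral {a..b} (\<lambda>u. f' u * of_real (sawtooth ((u - of_int l) / of_nat q)))
      + end_correction a b (\<lambda>n. if int q dvd n - l then f (of_int n) else 0)"
proof -
  define y where "y = (\<lambda>u::real. (u - of_int l) / of_nat q)"
  define p where "p = (\<lambda>t. of_int (l + int q * t) :: real)"
  define T where "T = {\<lfloor>y a\<rfloor> <.. \<lfloor>y b\<rfloor>}"
  \<comment> \<open>Chosen so that the right-continuous sawtooth at \<open>u\<close> is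
    \<open>c - y u\<close> plus the number of progression points in \<open>(a, u]\<close>.\<close>
  define c :: real where "c = 1 / 2 + of_int \<lfloor>y a\<rfloor>"
  have y_p: "y (p t) = of_int t" for t using q by (simp add: y_def p_def)
  have p_y: "p t \<le> u \<longleftrightarrow> t \<le> \<lfloor>y u\<rfloor>" for t u
    using q by (simp add: p_def y_def le_floor_iff field_simps)
  have y_mono: "y u \<le> y v" if "u \<le> v" for u v
    using q that by (simp add: y_def divide_right_mono)
  have T_iff: "t \<in> T \<longleftrightarrow> a < p t \<and> p t \<le> b" for t
    unfolding T_def p_y[symmetric] greaterThanAtMost_iff using p_y[of t a] by auto
  have floor_y: "of_int \<lfloor>y u\<rfloor> = of_int \<lfloor>y a\<rfloor> + (\<Sum>t\<in>T. if p t \<le> u then 1 else 0 :: real)"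
    if "u \<in> {a..b}" for u
  proof -
    have "\<lfloor>y a\<rfloor> \<le> \<lfloor>y u\<rfloor>" "\<lfloor>y u\<rfloor> \<le> \<lfloor>y b\<rfloor>" using that by (auto intro!: floor_mono y_mono)
    moreover from this have "T \<inter> {t. p t \<le> u} = {\<lfloor>y a\<rfloor> <.. \<lfloor>y u\<rfloor>}"
      by (auto simp: T_def p_y)
    ultimately show ?thesis by (simp add: T_def sum.If_cases)
  qed
  \<comment> \<open>the right-continuous version of the sawtooth, which gives integral endpoints full weight\<close>
  define \<phi> where "\<phi> = (\<lambda>u. 1 / 2 - y u + of_int \<lfloor>y u\<rfloor>)"
  have saw: "sawtooth (y u) = \<phi> u - (if y u \<in> \<int> then 1 / 2 else 0)" for u
    by (auto simp: sawtooth_def \<phi>_def frac_def elim: Ints_cases)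
  have dy: "((\<lambda>u. of_real (c - y u) :: complex) has_vector_derivative - 1 / of_nat q) (at u within {a..b})" for u
  proof -
    have "((\<lambda>u. c - y u) has_real_derivative - 1 / of_nat q) (at u within {a..b})"
      unfolding y_def using q by (auto intro!: derivative_eq_intros)
    from has_vector_derivative_of_real[OF this, where 'a = complex] show ?thesis by simp
  qed
  have f: "continuous_on {a..b} f" using deriv by (blast intro: continuous_on_vector_derivative)
  have y: "continuous_on {a..b} y" unfolding y_def using q by (intro continuous_intros) auto
  have "integral {a..b} (\<lambda>u. f' u * of_real (c - y u)) =
      f b * of_real (c - y b) - f a * of_real (c - y a) - integral {a..b} (\<lambda>u. f u * (- 1 / of_nat q))"
    by (intro integral_by_parts_within ab deriv dy f' continuous_intros)
  then have 1: "((\<lambda>u. f' u * of_real (c - y u)) has_integral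
      f b * of_real (c - y b) - f a * of_real (c - y a) + 1 / of_nat q * integral {a..b} f) {a..b}"
    using integrable_integral[OF integrable_continuous_real,
        of a b "\<lambda>u. f' u * of_real (c - y u)"] f' y
    by (simp add: continuous_intros)
  \<comment> \<open>A unit step at \<open>p t\<close> restricts the integral of \<open>f'\<close> to
    \<open>[p t, b]\<close>.\<close>
  have 2: "((\<lambda>u. f' u * of_real (if p t \<le> u then 1 else 0)) has_integral f b - f (p t)) {a..b}"
    if "t \<in> T" for t
  proof -
    have t: "a < p t" "p t \<le> b" using that T_iff by auto
    have "(f' has_integral f b - f (p t)) {p t..b}"
    proof (rule fundamental_theorem_of_calculus)
      fix x assume "x \<in> {p t..b}"
      then show "(f has_vector_derivative f' x) (at x within {p t..b})"
        using t by (intro has_vector_derivative_within_subset[OF deriv]) auto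
    qed (use t in auto)
    then have "((\<lambda>u. if u \<in> {p t..b} then f' u else 0) has_integral f b - f (p t)) {a..b}"
      using t by (subst has_integral_restrict) auto
    then show ?thesis
      by (rule has_integral_eq[rotated]) auto
  qed
  have "((\<lambda>u. f' u * of_real (c - y u) + (\<Sum>t\<in>T. f' u * of_real (if p t \<le> u then 1 else 0))) has_integral
      (f b * of_real (c - y b) - f a * of_real (c - y a) + 1 / of_nat q * integral {a..b} f)
      + (\<Sum>t\<in>T. f b - f (p t))) {a..b}"
    by (intro has_integral_add 1 has_integral_sum 2) (auto simp: T_def)
  then have "((\<lambda>u. f' u * of_real (\<phi> u)) has_integral
      (f b * of_real (c - y b) - f a * of_real (c - y a) + 1 / of_nat q * integral {a..b} f)
      + (\<Sum>t\<in>T. f b - f (p t))) {a..b}"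
  proof (rule has_integral_eq[rotated])
    fix u assume "u \<in> {a..b}"
    from floor_y[OF this] have "\<phi> u = (c - y u) + (\<Sum>t\<in>T. if p t \<le> u then 1 else 0)"
      by (simp add: \<phi>_def c_def)
    then show "f' u * of_real (c - y u) + (\<Sum>t\<in>T. f' u * of_real (if p t \<le> u then 1 else 0))
        = f' u * of_real (\<phi> u)"
      by (simp only: of_real_add of_real_sum distrib_left sum_distrib_left)
  qed
  then have 3: "integral {a..b} (\<lambda>u. f' u * of_real (\<phi> u)) =
      f b * of_real (c - y b) - f a * of_real (c - y a) + 1 / of_nat q * integral {a..b} f
      + (\<Sum>t\<in>T. f b - f (p t))"
    by (rule integral_unique)
  \<comment> \<open>The two versions of the sawtooth differ only at progression points, of which
    \<open>[a, b]\<close> contains finitely many.\<close>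
  have 4: "integral {a..b} (\<lambda>u. f' u * of_real (sawtooth (y u))) = integral {a..b} (\<lambda>u. f' u * of_real (\<phi> u))"
  proof (rule integral_spike[symmetric])
    show "negligible (p ` {\<lfloor>y a\<rfloor>..\<lfloor>y b\<rfloor>})" by (intro negligible_finite) auto
    fix u assume u: "u \<in> {a..b} - p ` {\<lfloor>y a\<rfloor>..\<lfloor>y b\<rfloor>}"
    have "y u \<notin> \<int>"
    proof
      assume "y u \<in> \<int>"
      then obtain t where t: "y u = of_int t" by (auto elim: Ints_cases)
      then have "u = p t" using q by (simp add: y_def p_def field_simps)
      moreover have "\<lfloor>y a\<rfloor> \<le> t" "t \<le> \<lfloor>y b\<rfloor>"
        using u t floor_mono[OF y_mono[of a u]] floor_mono[OF y_mono[of u b]] by auto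
      ultimately show False using u by auto
    qed
    then show "f' u * of_real (sawtooth (y u)) = f' u * of_real (\<phi> u)" by (simp add: saw)
  qed
  have 5: "(\<Sum>n | a < of_int n \<and> of_int n \<le> b \<and> int q dvd n - l. f (of_int n)) = (\<Sum>t\<in>T. f (p t))"
  proof -
    have "bij_betw (\<lambda>t. l + int q * t) T {n. a < of_int n \<and> of_int n \<le> b \<and> int q dvd n - l}"
    proof (rule bij_betwI')
      fix n assume n: "n \<in> {n. a < of_int n \<and> of_int n \<le> b \<and> int q dvd n - l}"
      then obtain t where "n - l = int q * t" by (auto elim: dvdE)
      then have "n = l + int q * t" by simp
      then show "\<exists>t\<in>T. n = l + int q * t" using n by (auto simp: T_iff p_def)
    qed (use q in \<open>auto simp: T_iff p_def\<close>)
    from sum.reindex_bij_betw[OF this, of "\<lambda>n. f (of_int n)"] show ?thesis by (simp add: p_def)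
  qed
  \<comment> \<open>Writing the number of steps as a difference of floors turns the coefficient of
    \<open>f b\<close> from \<open>c - y b\<close> into \<open>\<phi> b\<close>; the coefficient
    \<open>c - y a\<close> of \<open>f a\<close> is already \<open>\<phi> a\<close>.\<close>
  have "of_int \<lfloor>y b\<rfloor> = of_int \<lfloor>y a\<rfloor> + real (card T)"
    using floor_mono[OF y_mono[OF ab]] by (simp add: T_def)
  then have 6: "(\<Sum>t\<in>T. f b - f (p t)) = f b * of_real (of_int \<lfloor>y b\<rfloor> - of_int \<lfloor>y a\<rfloor>) - (\<Sum>t\<in>T. f (p t))"
    by (simp add: sum_subtractf)
  have 7: "end_value (\<lambda>n. if int q dvd n - l then f (of_int n) else 0) x = f x * (if y x \<in> \<int> then 1 else 0)" for x
    using progression_point_iff[OF q, of x l]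
    by (auto simp: end_value_def y_def elim: Ints_cases)
  have y_eq: "(u - of_int l) / of_nat q = y u" for u by (simp add: y_def)
  show ?thesis
    unfolding 5 y_eq unfolding 4 3 6 end_correction_def 7 unfolding saw
    by (simp add: \<phi>_def c_def algebra_simps diff_divide_distrib)
qed

section \<open>Fourier harmonics of any order and the expansion along one progression\<close>

text \<open>For \<open>s \<ge> 1\<close> the symmetric sum over \<open>n\<close> is classically
  minus the periodic Bernoulli function of order \<open>s\<close>, divided by the factorial of
  \<open>s\<close>. Keeping the frequency \<open>n\<close> separate allows integration by parts term
  by term.\<close>

definition harmonic :: "nat \<Rightarrow> real \<Rightarrow> int \<Rightarrow> complex" where
  "harmonic s y n = cis (2 * pi * of_int n * y) / (2 * of_real pi * \<i> * of_int n) ^ s"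

lemma sym_convergentD: "sym_convergent g \<Longrightarrow> sym_partial g \<longlonglongrightarrow> sym_sum g"
  unfolding sym_convergent_def sym_sum_def by (rule convergent_LIMSEQ_iff[THEN iffD1])

lemma sym_limI:
  assumes "sym_partial g \<longlonglongrightarrow> L"
  shows "sym_convergent g" "sym_sum g = L"
  using assms unfolding sym_convergent_def sym_sum_def by (auto simp: convergent_def limI)

lemma sym_partial_cong:
  "(\<And>n. n \<noteq> 0 \<Longrightarrow> g n = h n) \<Longrightarrow> sym_partial g N = sym_partial h N"
  unfolding sym_partial_def by (intro sum.cong) auto

lemma harmonic_1_tendsto: "sym_partial (harmonic 1 y) \<longlonglongrightarrow> of_real (sawtooth y)"
proof -
  have "sym_partial (harmonic 1 y) = (\<lambda>N. of_real (saw_partial N y))"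
    by (rule ext) (simp add: harmonic_def[abs_def] sym_partial_sawtooth)
  then show ?thesis by (simp add: saw_partial_tendsto tendsto_of_real)
qed

text \<open>For \<open>s = 1\<close> convergence is that of the sawtooth series; for
  \<open>s \<ge> 2\<close> the terms are dominated by a multiple of
  \<open>1 / n ^ 2\<close>.\<close>

lemma sym_convergent_harmonic:
  assumes "1 \<le> s"
  shows "sym_convergent (harmonic s y)"
proof (cases "s = 1")
  case True
  then show ?thesis using sym_limI(1)[OF harmonic_1_tendsto] by simp
next
  case False
  let ?g = "\<lambda>n. harmonic s y (int n) + harmonic s y (- int n)"
  have "summable (\<lambda>n. ?g (Suc n))"
  proof (rule summable_comparison_test)
    show "summable (\<lambda>n. 2 * inverse (real (Suc n) ^ 2))"
      using inverse_power_summable[of 2, where 'a = real]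
      by (intro summable_mult) (subst summable_Suc_iff, simp)
    have "norm (?g (Suc n)) \<le> 2 * inverse (real (Suc n) ^ 2)" for n
    proof -
      have "real (Suc n) ^ 2 \<le> real (Suc n) ^ s"
        using assms False by (intro power_increasing) auto
      also have "\<dots> \<le> (2 * pi * real (Suc n)) ^ s"
      proof (rule power_mono)
        have "1 \<le> 2 * pi" using pi_gt3 by simp
        then show "real (Suc n) \<le> 2 * pi * real (Suc n)"
          using mult_right_mono[of 1 "2 * pi" "real (Suc n)"] by simp
      qed simp
      finally have "inverse ((2 * pi * real (Suc n)) ^ s) \<le> inverse (real (Suc n) ^ 2)"
        by (intro le_imp_inverse_le) auto
      moreover have "norm (harmonic s y (int (Suc n))) = inverse ((2 * pi * real (Suc n)) ^ s)"
        "norm (harmonic s y (- int (Suc n))) = inverse ((2 * pi * real (Suc n)) ^ s)"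
        by (simp_all add: harmonic_def norm_divide norm_power norm_mult norm_inverse divide_inverse del: of_nat_Suc)
      ultimately show ?thesis
        using norm_triangle_ineq[of "harmonic s y (int (Suc n))" "harmonic s y (- int (Suc n))"]
        by linarith
    qed
    then show "\<exists>N. \<forall>n\<ge>N. norm (?g (Suc n)) \<le> 2 * inverse (real (Suc n) ^ 2)" by blast
  qed
  then have "convergent (\<lambda>N. \<Sum>n<N. ?g (Suc n))" by (simp add: summable_iff_convergent)
  moreover have "(\<Sum>n<N. ?g (Suc n)) = sym_partial (harmonic s y) N" for N
    unfolding sym_partial_eq_sum_nat
    by (rule sum.reindex_bij_witness[of _ "\<lambda>n. n - 1" Suc]) auto
  ultimately show ?thesis by (simp add: sym_convergent_def)
qed

lemma cont_derivs_on_has_vector_derivative: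
  assumes "cont_derivs_on q S f" "r < q" "x \<in> S"
  shows "(nth_deriv_within S r f has_vector_derivative nth_deriv_within S (Suc r) f x) (at x within S)"
  using assms by (simp add: cont_derivs_on_def vector_derivative_works)

lemma cont_derivs_on_continuous:
  "cont_derivs_on q S f \<Longrightarrow> r \<le> q \<Longrightarrow> continuous_on S (nth_deriv_within S r f)"
  by (simp add: cont_derivs_on_def)

lemma cont_derivs_on_mono: "cont_derivs_on q S f \<Longrightarrow> p \<le> q \<Longrightarrow> cont_derivs_on p S f"
  by (simp add: cont_derivs_on_def)

text \<open>The harmonic of order \<open>s + 1\<close> in the rescaled variable has derivative the
  harmonic of order \<open>s\<close> divided by \<open>q\<close>, so each increase of the order
  costs a factor \<open>q\<close>.\<close>

lemma fourier_integral_by_parts: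
  fixes F F' :: "real \<Rightarrow> complex" and l :: int
  assumes ab: "a \<le> b" and q: "0 < (q :: nat)" and n: "n \<noteq> 0"
    and deriv: "\<And>x. x \<in> {a..b} \<Longrightarrow> (F has_vector_derivative F' x) (at x within {a..b})"
    and F': "continuous_on {a..b} F'"
  shows "integral {a..b} (\<lambda>u. F u * harmonic s ((u - of_int l) / of_nat q) n) =
      of_nat q * (F b * harmonic (Suc s) ((b - of_int l) / of_nat q) n
        - F a * harmonic (Suc s) ((a - of_int l) / of_nat q) n
        - integral {a..b} (\<lambda>u. F' u * harmonic (Suc s) ((u - of_int l) / of_nat q) n))"
proof -
  let ?y = "\<lambda>u. (u - of_int l) / of_nat q"
  let ?h = "\<lambda>s u. harmonic s (?y u) n"
  have h: "(?h (Suc s) has_vector_derivative ?h s x / of_nat q) (at x within {a..b})" for x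
    unfolding harmonic_def has_vector_derivative_def using n q
    by (auto intro!: derivative_eq_intros simp: fun_eq_iff scaleR_conv_of_real field_simps)
  have cont: "continuous_on {a..b} (?h s)" for s
    unfolding harmonic_def using q n by (intro continuous_intros) auto
  have "integral {a..b} (\<lambda>u. F' u * ?h (Suc s) u) =
      F b * ?h (Suc s) b - F a * ?h (Suc s) a - integral {a..b} (\<lambda>u. F u * (?h s u / of_nat q))"
    by (intro integral_by_parts_within ab deriv F' h continuous_intros cont) (use q in auto)
  then show ?thesis using q by (simp add: field_simps)
qed

lemma continuous_on_harmonic:
  "continuous_on S y \<Longrightarrow> continuous_on S (\<lambda>u. harmonic s (y u) n)"
  \<comment> \<open>For \<open>n = 0\<close> the denominator may be 0, but the function is then
    constant in \<open>u\<close>.\<close>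
  unfolding harmonic_def by (cases "n = 0") (auto intro!: continuous_intros)

text \<open>Induction on \<open>R\<close>. The base case is the sawtooth formula with its integral
  evaluated termwise. In the step, integration by parts at each \<open>n\<close> writes the new
  remainder series as boundary series of order at least 2 minus a multiple of the old one, so its
  convergence is inherited.\<close>

lemma progression_formula:
  fixes f :: "real \<Rightarrow> complex" and q :: nat and l :: int
  assumes ab: "a < b" and q: "0 < q" and cd: "cont_derivs_on (R + 1) {a..b} f"
  defines "D \<equiv> \<lambda>r. nth_deriv_within {a..b} r f"
    and "y \<equiv> \<lambda>x::real. (x - of_int l) / of_nat q"
  defines "rem \<equiv> \<lambda>r n. integral {a..b} (\<lambda>u. D (Suc r) u * harmonic (Suc r) (y u) n)"
  shows "sym_convergent (rem R) \<and>
    (\<Sum>n | a < of_int n \<and> of_int n \<le> b \<and> int q dvd n - l. f (of_int n)) =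
      1 / of_nat q * integral {a..b} f
      + (\<Sum>r=0..R. (- of_nat q) ^ r *
          (D r b * sym_sum (harmonic (Suc r) (y b)) - D r a * sym_sum (harmonic (Suc r) (y a))))
      - (- of_nat q) ^ R * sym_sum (rem R)
      + end_correction a b (\<lambda>n. if int q dvd n - l then f (of_int n) else 0)"
  using cd
proof (induction R)
  case 0
  have cont: "continuous_on {a..b} (D 1)"
    using cont_derivs_on_continuous[OF 0, of 1] by (simp add: D_def)
  have y: "continuous_on {a..b} y" unfolding y_def using q by (intro continuous_intros) auto
  have partial: "sym_partial (rem 0) = (\<lambda>N. integral {a..b} (\<lambda>u. D 1 u * of_real (saw_partial N (y u))))"
  proof
    fix N
    have "integral {a..b} (\<lambda>u. D 1 u * of_real (saw_partial N (y u))) =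
        integral {a..b} (\<lambda>u. \<Sum>n | n \<noteq> 0 \<and> \<bar>n\<bar> \<le> int N. D 1 u * harmonic 1 (y u) n)"
      by (simp add: sym_partial_sawtooth[symmetric] sym_partial_def harmonic_def sum_distrib_left)
    also have "\<dots> = sym_partial (rem 0) N"
      unfolding sym_partial_def rem_def One_nat_def[symmetric]
    proof (rule integral_sum)
      have "{n. n \<noteq> 0 \<and> \<bar>n\<bar> \<le> int N} \<subseteq> {- int N..int N}" by auto
      then show "finite {n. n \<noteq> 0 \<and> \<bar>n\<bar> \<le> int N}" by (rule finite_subset) simp
    qed (intro integrable_continuous_real continuous_intros cont continuous_on_harmonic y)
    finally show "sym_partial (rem 0) N = integral {a..b} (\<lambda>u. D 1 u * of_real (saw_partial N (y u)))"
      by simp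
  qed
  \<comment> \<open>The partial sums are bounded by 1, so \<open>norm (D 1 u)\<close> is an
    integrable majorant.\<close>
  have "(\<lambda>N. integral {a..b} (\<lambda>u. D 1 u * of_real (saw_partial N (y u))))
      \<longlonglongrightarrow> integral {a..b} (\<lambda>u. D 1 u * of_real (sawtooth (y u)))"
  proof (rule dominated_convergence(2))
    show "(\<lambda>u. norm (D 1 u)) integrable_on {a..b}"
      by (intro integrable_continuous_real continuous_intros cont)
    show "(\<lambda>u. D 1 u * of_real (saw_partial N (y u))) integrable_on {a..b}" for N
      unfolding saw_partial_def using q
      by (intro integrable_continuous_real continuous_intros cont y) auto
    show "norm (D 1 u * of_real (saw_partial N (y u))) \<le> norm (D 1 u)" for N u
      using abs_saw_partial_le[of N "y u"] by (simp add: norm_mult mult_left_le)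
    show "(\<lambda>N. D 1 u * of_real (saw_partial N (y u))) \<longlonglongrightarrow> D 1 u * of_real (sawtooth (y u))" for u
      by (intro tendsto_intros saw_partial_tendsto)
  qed
  then have "sym_partial (rem 0) \<longlonglongrightarrow> integral {a..b} (\<lambda>u. D 1 u * of_real (sawtooth (y u)))"
    by (simp only: partial)
  note rem0 = sym_limI[OF this]
  have "(D 0 has_vector_derivative D (Suc 0) x) (at x within {a..b})" if "x \<in> {a..b}" for x
    unfolding D_def using cont_derivs_on_has_vector_derivative[OF 0 _ that] by simp
  then have "(\<Sum>n | a < of_int n \<and> of_int n \<le> b \<and> int q dvd n - l. f (of_int n)) =
      1 / of_nat q * integral {a..b} f + f b * of_real (sawtooth (y b)) - f a * of_real (sawtooth (y a))
      - integral {a..b} (\<lambda>u. D 1 u * of_real (sawtooth (y u)))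
      + end_correction a b (\<lambda>n. if int q dvd n - l then f (of_int n) else 0)"
    unfolding y_def using ab cont by (intro progression_sum_sawtooth q) (auto simp: D_def)
  moreover have "sym_sum (harmonic (Suc 0) x) = of_real (sawtooth x)" for x
    using sym_limI(2)[OF harmonic_1_tendsto] by simp
  ultimately show ?case using rem0 by (simp add: D_def)
next
  case (Suc R)
  note cd = Suc.prems
  have IH: "sym_convergent (rem R)"
    "(\<Sum>n | a < of_int n \<and> of_int n \<le> b \<and> int q dvd n - l. f (of_int n)) =
      1 / of_nat q * integral {a..b} f
      + (\<Sum>r=0..R. (- of_nat q) ^ r *
          (D r b * sym_sum (harmonic (Suc r) (y b)) - D r a * sym_sum (harmonic (Suc r) (y a))))
      - (- of_nat q) ^ R * sym_sum (rem R)
      + end_correction a b (\<lambda>n. if int q dvd n - l then f (of_int n) else 0)"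
    using Suc.IH[OF cont_derivs_on_mono[OF cd]] by auto
  let ?B = "\<lambda>x. D (Suc R) x * sym_sum (harmonic (Suc (Suc R)) (y x))"
  have deriv: "(D (Suc R) has_vector_derivative D (Suc (Suc R)) x) (at x within {a..b})"
    if "x \<in> {a..b}" for x
    unfolding D_def using cont_derivs_on_has_vector_derivative[OF cd _ that, of "Suc R"]
    by (simp del: nth_deriv_within.simps)
  have cont: "continuous_on {a..b} (D (Suc (Suc R)))"
    using cont_derivs_on_continuous[OF cd, of "Suc (Suc R)"] by (simp add: D_def)
  have "rem (Suc R) n = D (Suc R) b * harmonic (Suc (Suc R)) (y b) n
      - D (Suc R) a * harmonic (Suc (Suc R)) (y a) n - 1 / of_nat q * rem R n" if "n \<noteq> 0" for n
    using fourier_integral_by_parts[OF less_imp_le[OF ab] q that deriv cont, of "Suc R" l] q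
    by (simp add: rem_def y_def)
  then have "sym_partial (rem (Suc R)) N = sym_partial (\<lambda>n. D (Suc R) b * harmonic (Suc (Suc R)) (y b) n
      - D (Suc R) a * harmonic (Suc (Suc R)) (y a) n - 1 / of_nat q * rem R n) N" for N
    by (rule sym_partial_cong)
  then have "sym_partial (rem (Suc R)) = (\<lambda>N. D (Suc R) b * sym_partial (harmonic (Suc (Suc R)) (y b)) N
      - D (Suc R) a * sym_partial (harmonic (Suc (Suc R)) (y a)) N - 1 / of_nat q * sym_partial (rem R) N)"
    by (intro ext) (simp add: sym_partial_def sum_subtractf sum_distrib_left sum_divide_distrib)
  moreover have "\<dots> \<longlonglongrightarrow> ?B b - ?B a - 1 / of_nat q * sym_sum (rem R)"
    by (intro tendsto_intros sym_convergentD sym_convergent_harmonic IH(1)) auto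
  ultimately have "sym_partial (rem (Suc R)) \<longlonglongrightarrow> ?B b - ?B a - 1 / of_nat q * sym_sum (rem R)"
    by simp
  note rem = sym_limI[OF this]
  \<comment> \<open>The new boundary term and the new remainder together equal the old remainder, so
    the total is unchanged.\<close>
  have "(- of_nat q) ^ Suc R * (?B b - ?B a) - (- of_nat q) ^ Suc R * sym_sum (rem (Suc R))
      = - ((- of_nat q) ^ R * sym_sum (rem R))"
    using q by (simp add: rem(2) algebra_simps)
  then have "(\<Sum>r=0..R. (- of_nat q) ^ r *
          (D r b * sym_sum (harmonic (Suc r) (y b)) - D r a * sym_sum (harmonic (Suc r) (y a))))
      - (- of_nat q) ^ R * sym_sum (rem R)
    = (\<Sum>r=0..Suc R. (- of_nat q) ^ r *
          (D r b * sym_sum (harmonic (Suc r) (y b)) - D r a * sym_sum (harmonic (Suc r) (y a))))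
      - (- of_nat q) ^ Suc R * sym_sum (rem (Suc R))"
    by (simp add: algebra_simps)
  then show ?case using IH(2) rem(1) by (simp add: algebra_simps)
qed

section \<open>Finite weighted combinations of progressions\<close>

text \<open>The series may converge only conditionally, but a finite combination commutes with the
  symmetric limit. Agreement is asked only for \<open>n \<noteq> 0\<close>, since the term at 0 is
  never summed.\<close>

lemma sym_sum_linear:
  assumes "finite I" "\<And>i. i \<in> I \<Longrightarrow> sym_convergent (g i)"
    and "\<And>n. n \<noteq> 0 \<Longrightarrow> h n = (\<Sum>i\<in>I. c i * g i n)"
  shows "sym_convergent h" "sym_sum h = (\<Sum>i\<in>I. c i * sym_sum (g i))"
proof -
  have "sym_partial h N = (\<Sum>i\<in>I. c i * sym_partial (g i) N)" for N
  proof -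
    have "sym_partial h N = sym_partial (\<lambda>n. \<Sum>i\<in>I. c i * g i n) N"
      using assms(3) by (rule sym_partial_cong)
    also have "\<dots> = (\<Sum>i\<in>I. c i * sym_partial (g i) N)"
      unfolding sym_partial_def by (subst sum.swap) (simp add: sum_distrib_left)
    finally show ?thesis .
  qed
  moreover have "(\<lambda>N. \<Sum>i\<in>I. c i * sym_partial (g i) N) \<longlonglongrightarrow> (\<Sum>i\<in>I. c i * sym_sum (g i))"
    using assms(2) by (intro tendsto_intros sym_convergentD)
  ultimately have "sym_partial h \<longlonglongrightarrow> (\<Sum>i\<in>I. c i * sym_sum (g i))" by (simp add: LIMSEQ_def)
  then show "sym_convergent h" "sym_sum h = (\<Sum>i\<in>I. c i * sym_sum (g i))" by (rule sym_limI)+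
qed

lemma end_correction_sum:
  "end_correction a b (\<lambda>n. \<Sum>i\<in>I. c i * g i n) = (\<Sum>i\<in>I. c i * end_correction a b (g i))"
proof -
  have "end_value (\<lambda>n. \<Sum>i\<in>I. c i * g i n) x = (\<Sum>i\<in>I. c i * end_value (g i) x)" for x
    by (simp add: end_value_def)
  then show ?thesis
    by (simp add: end_correction_def sum_divide_distrib sum_subtractf right_diff_distrib
        diff_divide_distrib)
qed

text \<open>
  The factor \<open>k\<close> is kept outside the moduli \<open>k * \<mu> i\<close> because the formulas have \<open>k ^ r\<close> outside the
  series but \<open>m ^ r\<close> inside.
\<close>

lemma weighted_progressions:
  fixes f :: "real \<Rightarrow> complex" and k :: nat and \<mu> :: "'i \<Rightarrow> nat" and l :: "'i \<Rightarrow> int"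
    and w :: "'i \<Rightarrow> complex"
  assumes ab: "a < b" and cd: "cont_derivs_on (R + 1) {a..b} f" and k: "0 < k"
    and I: "finite I" and \<mu>: "\<forall>i\<in>I. 0 < \<mu> i"
    and H: "\<And>r x n. H r x n = (\<Sum>i\<in>I. w i * of_nat (\<mu> i) ^ r *
              cis (2 * pi * of_int n * ((x - of_int (l i)) / of_nat (k * \<mu> i))))"
    and W: "\<And>n. W n = (\<Sum>i\<in>I. if int (k * \<mu> i) dvd n - l i then w i else 0)"
  defines "D \<equiv> \<lambda>r. nth_deriv_within {a..b} r f"
    and "c \<equiv> \<lambda>n :: int. 2 * of_real pi * \<i> * of_int n"
  shows "\<And>r x. sym_convergent (\<lambda>n. H r x n / c n ^ (r + 1))"
    and "sym_convergent (\<lambda>n. integral {a..b} (\<lambda>u. D (R + 1) u * H R u n) / c n ^ (R + 1))"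
    and "(\<Sum>n | a < of_int n \<and> of_int n \<le> b. W n * f (of_int n)) =
      1 / of_nat k * (\<Sum>i\<in>I. w i / of_nat (\<mu> i)) * integral {a..b} f
      + (\<Sum>r=0..R. (- of_nat k) ^ r *
          (D r b * sym_sum (\<lambda>n. H r b n / c n ^ (r + 1)) - D r a * sym_sum (\<lambda>n. H r a n / c n ^ (r + 1))))
      - (- of_nat k) ^ R *
          sym_sum (\<lambda>n. integral {a..b} (\<lambda>u. D (R + 1) u * H R u n) / c n ^ (R + 1))
      + end_correction a b (\<lambda>n. W n * f (of_int n))"
proof -
  let ?q = "\<lambda>i. k * \<mu> i"
  let ?y = "\<lambda>i x. (x - of_int (l i)) / of_nat (?q i) :: real"
  let ?rem = "\<lambda>i n. integral {a..b} (\<lambda>u. D (Suc R) u * harmonic (Suc R) (?y i u) n)"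
  let ?P = "\<lambda>i. \<Sum>n | a < of_int n \<and> of_int n \<le> b \<and> int (?q i) dvd n - l i. f (of_int n)"
  let ?e = "\<lambda>i n. if int (?q i) dvd n - l i then f (of_int n) else 0"
  have prog: "sym_convergent (?rem i)"
    "?P i = 1 / of_nat (?q i) * integral {a..b} f
      + (\<Sum>r=0..R. (- of_nat (?q i)) ^ r *
          (D r b * sym_sum (harmonic (Suc r) (?y i b)) - D r a * sym_sum (harmonic (Suc r) (?y i a))))
      - (- of_nat (?q i)) ^ R * sym_sum (?rem i) + end_correction a b (?e i)" if "i \<in> I" for i
    using progression_formula[OF ab _ cd, of "?q i" "l i"] k \<mu> that unfolding D_def by auto
  \<comment> \<open>The shift by \<open>l i\<close> sits in the argument of \<open>cis\<close>, so
    division by \<open>c n ^ (r + 1)\<close> leaves a combination of harmonics whose coefficients do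
    not depend on \<open>n\<close>.\<close>
  have harm: "H r x n / c n ^ (r + 1) =
      (\<Sum>i\<in>I. (w i * of_nat (\<mu> i) ^ r) * harmonic (Suc r) (?y i x) n)" for r x n
    by (simp add: H c_def harmonic_def sum_divide_distrib)
  show "sym_convergent (\<lambda>n. H r x n / c n ^ (r + 1))" for r x
    by (rule sym_sum_linear(1)[OF I _ harm]) (auto intro: sym_convergent_harmonic)
  have S: "sym_sum (\<lambda>n. H r x n / c n ^ (r + 1)) =
      (\<Sum>i\<in>I. (w i * of_nat (\<mu> i) ^ r) * sym_sum (harmonic (Suc r) (?y i x)))" for r x
    by (rule sym_sum_linear(2)[OF I _ harm]) (auto intro: sym_convergent_harmonic)
  have cont: "continuous_on {a..b} (D (Suc R))"
    using cont_derivs_on_continuous[OF cd, of "Suc R"] by (simp add: D_def)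
  have rem: "integral {a..b} (\<lambda>u. D (R + 1) u * H R u n) / c n ^ (R + 1) =
      (\<Sum>i\<in>I. (w i * of_nat (\<mu> i) ^ R) * ?rem i n)" for n
  proof -
    have "integral {a..b} (\<lambda>u. D (R + 1) u * H R u n) / c n ^ (R + 1)
        = integral {a..b} (\<lambda>u. D (R + 1) u * H R u n / c n ^ (R + 1))"
      by simp
    also have "\<dots> = integral {a..b} (\<lambda>u. \<Sum>i\<in>I. (w i * of_nat (\<mu> i) ^ R) *
        (D (Suc R) u * harmonic (Suc R) (?y i u) n))"
      by (intro integral_cong) (simp add: times_divide_eq_right[symmetric] harm[of R, simplified]
          sum_distrib_left mult_ac del: times_divide_eq_right)
    also have "\<dots> = (\<Sum>i\<in>I. (w i * of_nat (\<mu> i) ^ R) * ?rem i n)"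
      using k \<mu>
      by (subst integral_sum[OF I])
        (fastforce intro!: integrable_continuous_real continuous_intros cont continuous_on_harmonic)+
    finally show ?thesis .
  qed
  show "sym_convergent (\<lambda>n. integral {a..b} (\<lambda>u. D (R + 1) u * H R u n) / c n ^ (R + 1))"
    by (rule sym_sum_linear(1)[OF I _ rem]) (rule prog)
  have V: "sym_sum (\<lambda>n. integral {a..b} (\<lambda>u. D (R + 1) u * H R u n) / c n ^ (R + 1)) =
      (\<Sum>i\<in>I. (w i * of_nat (\<mu> i) ^ R) * sym_sum (?rem i))"
    by (rule sym_sum_linear(2)[OF I _ rem]) (rule prog)
  have W_f: "W n * f (of_int n) = (\<Sum>i\<in>I. w i * ?e i n)" for n
    unfolding W sum_distrib_right by (intro sum.cong) auto
  have "{n. a < of_int n \<and> of_int n \<le> b} \<subseteq> {\<lfloor>a\<rfloor>..\<lfloor>b\<rfloor>}"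
    by (auto simp: le_floor_iff) linarith
  then have fin: "finite {n. a < of_int n \<and> of_int n \<le> b}" by (rule finite_subset) simp
  have "(\<Sum>n | a < of_int n \<and> of_int n \<le> b. W n * f (of_int n)) =
      (\<Sum>i\<in>I. w i * (\<Sum>n | a < of_int n \<and> of_int n \<le> b. ?e i n))"
    unfolding W_f by (subst sum.swap) (simp add: sum_distrib_left)
  also have "\<dots> = (\<Sum>i\<in>I. w i * ?P i)"
  proof -
    have "(\<Sum>n | a < of_int n \<and> of_int n \<le> b. ?e i n) = ?P i" for i
      using sum.inter_filter[OF fin, of "\<lambda>n. f (of_int n)" "\<lambda>n. int (?q i) dvd n - l i"]
      by (simp add: conj_assoc)
    then show ?thesis by simp
  qed
  also have "\<dots> = (\<Sum>i\<in>I. 1 / of_nat k * (w i / of_nat (\<mu> i)) * integral {a..b} f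
      + (\<Sum>r=0..R. (- of_nat k) ^ r *
          (D r b * ((w i * of_nat (\<mu> i) ^ r) * sym_sum (harmonic (Suc r) (?y i b)))
          - D r a * ((w i * of_nat (\<mu> i) ^ r) * sym_sum (harmonic (Suc r) (?y i a)))))
      - (- of_nat k) ^ R * ((w i * of_nat (\<mu> i) ^ R) * sym_sum (?rem i))
      + w i * end_correction a b (?e i))"
  proof (rule sum.cong[OF refl])
    fix i assume i: "i \<in> I"
    \<comment> \<open>The sign and \<open>k\<close> leave the sum over \<open>i\<close>; the power
      of \<open>\<mu> i\<close> joins the weight.\<close>
    have pow: "(- of_nat (?q i) :: complex) ^ r = (- of_nat k) ^ r * of_nat (\<mu> i) ^ r" for r :: nat
    proof -
      have "- of_nat (?q i) = (- of_nat k) * (of_nat (\<mu> i) :: complex)" by simp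
      then show ?thesis by (simp only: power_mult_distrib)
    qed
    show "w i * ?P i = 1 / of_nat k * (w i / of_nat (\<mu> i)) * integral {a..b} f
      + (\<Sum>r=0..R. (- of_nat k) ^ r *
          (D r b * ((w i * of_nat (\<mu> i) ^ r) * sym_sum (harmonic (Suc r) (?y i b)))
          - D r a * ((w i * of_nat (\<mu> i) ^ r) * sym_sum (harmonic (Suc r) (?y i a)))))
      - (- of_nat k) ^ R * ((w i * of_nat (\<mu> i) ^ R) * sym_sum (?rem i))
      + w i * end_correction a b (?e i)"
      unfolding prog(2)[OF i] pow
      by (simp add: distrib_left right_diff_distrib sum_distrib_left sum_subtractf mult_ac)
  qed
  also have "\<dots> = 1 / of_nat k * (\<Sum>i\<in>I. w i / of_nat (\<mu> i)) * integral {a..b} f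
      + (\<Sum>r=0..R. (- of_nat k) ^ r *
          (D r b * (\<Sum>i\<in>I. (w i * of_nat (\<mu> i) ^ r) * sym_sum (harmonic (Suc r) (?y i b)))
          - D r a * (\<Sum>i\<in>I. (w i * of_nat (\<mu> i) ^ r) * sym_sum (harmonic (Suc r) (?y i a)))))
      - (- of_nat k) ^ R * (\<Sum>i\<in>I. (w i * of_nat (\<mu> i) ^ R) * sym_sum (?rem i))
      + (\<Sum>i\<in>I. w i * end_correction a b (?e i))"
  proof -
    have swap: "(\<Sum>i\<in>I. \<Sum>r=0..R. g r * (u r * h i r - v r * h' i r)) =
        (\<Sum>r=0..R. g r * (u r * (\<Sum>i\<in>I. h i r) - v r * (\<Sum>i\<in>I. h' i r)))"
      for g u v :: "nat \<Rightarrow> complex" and h h'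
      by (subst sum.swap) (simp add: sum_distrib_left sum_subtractf right_diff_distrib)
    show ?thesis
      unfolding sum.distrib sum_subtractf swap
      by (simp add: sum_distrib_left sum_distrib_right)
  qed
  finally show "(\<Sum>n | a < of_int n \<and> of_int n \<le> b. W n * f (of_int n)) =
      1 / of_nat k * (\<Sum>i\<in>I. w i / of_nat (\<mu> i)) * integral {a..b} f
      + (\<Sum>r=0..R. (- of_nat k) ^ r *
          (D r b * sym_sum (\<lambda>n. H r b n / c n ^ (r + 1)) - D r a * sym_sum (\<lambda>n. H r a n / c n ^ (r + 1))))
      - (- of_nat k) ^ R *
          sym_sum (\<lambda>n. integral {a..b} (\<lambda>u. D (R + 1) u * H R u n) / c n ^ (R + 1))
      + end_correction a b (\<lambda>n. W n * f (of_int n))"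
    unfolding S V W_f end_correction_sum .
qed

section \<open>Residue classes and divisors\<close>

text \<open>Exactly one representative in \<open>1..k\<close> is congruent to \<open>n\<close>, and
  \<open>g\<close> depends only on the class.\<close>

lemma sum_residues:
  fixes g :: "int \<Rightarrow> complex"
  assumes k: "0 < k" and g: "\<And>m n. int k dvd m - n \<Longrightarrow> g m = g n"
  shows "(\<Sum>r=1..k. if int k dvd n - int r then g (int r) else 0) = g n"
proof -
  \<comment> \<open>The shift by one before and after reduction puts the representative in
    \<open>1..k\<close> instead of \<open>0..k-1\<close>.\<close>
  define s where "s = nat ((n - 1) mod int k) + 1"
  have s: "int s = (n - 1) mod int k + 1" using k by (simp add: s_def)
  have "s \<in> {1..k}"
  proof -
    have "(n - 1) mod int k < int k" "0 \<le> (n - 1) mod int k" using k by simp_all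
    then have "int s \<le> int k" "1 \<le> int s" unfolding s by linarith+
    then show ?thesis by simp
  qed
  have dvd_s: "int k dvd n - int s"
    by (simp add: s algebra_simps) (metis diff_diff_eq dvd_minus_mod)
  have "r = s" if r: "r \<in> {1..k}" and dvd: "int k dvd n - int r" for r
  proof -
    have "int k dvd (n - int r) - (n - int s)" by (intro dvd_diff dvd dvd_s)
    then have "int k dvd int s - int r" by simp
    moreover have "\<bar>int s - int r\<bar> < int k" using r \<open>s \<in> {1..k}\<close> by auto
    ultimately show ?thesis using dvd_imp_le_int[of "int s - int r" "int k"] by force
  qed
  then have "(\<Sum>r=1..k. if int k dvd n - int r then g (int r) else 0) =
      (\<Sum>r\<in>{s}. if int k dvd n - int r then g (int r) else 0)"
    using \<open>s \<in> {1..k}\<close> by (intro sum.mono_neutral_right) auto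
  also have "\<dots> = g n" using dvd_s g[OF dvd_s] by simp
  finally show ?thesis .
qed

lemma finite_nat_le_real: "finite {m::nat. 1 \<le> m \<and> of_nat m \<le> (b::real) \<and> P m}"
proof (rule finite_subset)
  show "{m::nat. 1 \<le> m \<and> of_nat m \<le> b \<and> P m} \<subseteq> {..nat \<lfloor>b\<rfloor>}"
    by (auto simp: le_nat_floor)
qed simp

lemma divisors_upto_eq_sum:
  "of_nat (divisors_upto b n) =
    (\<Sum>m::nat | 1 \<le> m \<and> of_nat m \<le> b. if int m dvd n then 1 else 0 :: complex)"
proof -
  have "finite {m::nat. 1 \<le> m \<and> of_nat m \<le> b}" using finite_nat_le_real[of b "\<lambda>_. True"] by simp
  then show ?thesis
    by (simp add: divisors_upto_def sum.If_cases Int_def conj_assoc)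
qed

text \<open>For a factorization \<open>n = m * j\<close>, the residues \<open>r1\<close> of
  \<open>m\<close> and \<open>r2\<close> of \<open>j\<close> are the only pair that contributes,
  since \<open>k * m\<close> divides \<open>n - m * r2\<close> exactly when \<open>k\<close> divides
  \<open>j - r2\<close>. Periodicity used in each factor in turn replaces
  \<open>chi (r1 * r2)\<close> by \<open>chi (m * j)\<close>, so each divisor
  \<open>m \<le> b\<close> of \<open>n\<close> contributes \<open>chi n\<close>.\<close>

lemma sum_residue_pairs_eq_divisors:
  fixes chi :: "int \<Rightarrow> complex"
  assumes k: "0 < k" and per: "\<And>m n. int k dvd m - n \<Longrightarrow> chi m = chi n"
  shows "(\<Sum>r1=1..k. \<Sum>r2=1..k. chi (int (r1 * r2)) *
      (\<Sum>m::nat | 1 \<le> m \<and> of_nat m \<le> b \<and> [m = r1] (mod k).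
        if int (k * m) dvd n - int (m * r2) then 1 else 0)) = chi n * of_nat (divisors_upto b n)"
proof -
  let ?M = "{m::nat. 1 \<le> m \<and> of_nat m \<le> b}"
  have fin: "finite ?M" using finite_nat_le_real[of b "\<lambda>_. True"] by simp
  have "(\<Sum>m::nat | 1 \<le> m \<and> of_nat m \<le> b \<and> [m = r1] (mod k).
        if int (k * m) dvd n - int (m * r2) then 1 else 0 :: complex)
      = (\<Sum>m\<in>?M. if int k dvd int m - int r1 then if int (k * m) dvd n - int (m * r2) then 1 else 0 else 0)"
    for r1 r2
    using sum.inter_filter[OF fin, of "\<lambda>m. if int (k * m) dvd n - int (m * r2) then 1 else 0 :: complex"
        "\<lambda>m. [m = r1] (mod k)"]
    by (simp add: conj_assoc cong_iff_dvd_diff flip: cong_int_iff)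
  then have "(\<Sum>r1=1..k. \<Sum>r2=1..k. chi (int (r1 * r2)) *
      (\<Sum>m::nat | 1 \<le> m \<and> of_nat m \<le> b \<and> [m = r1] (mod k).
        if int (k * m) dvd n - int (m * r2) then 1 else 0)) =
      (\<Sum>r1=1..k. \<Sum>r2=1..k. \<Sum>m\<in>?M. if int k dvd int m - int r1 then
        if int (k * m) dvd n - int (m * r2) then chi (int (r1 * r2)) else 0 else 0)"
    by (auto simp: sum_distrib_left intro!: sum.cong)
  also have "\<dots> = (\<Sum>r1=1..k. \<Sum>m\<in>?M. \<Sum>r2=1..k. if int k dvd int m - int r1 then
        if int (k * m) dvd n - int (m * r2) then chi (int (r1 * r2)) else 0 else 0)"
    by (intro sum.cong refl sum.swap)
  also have "\<dots> = (\<Sum>m\<in>?M. \<Sum>r1=1..k. \<Sum>r2=1..k. if int k dvd int m - int r1 then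
        if int (k * m) dvd n - int (m * r2) then chi (int (r1 * r2)) else 0 else 0)"
    by (rule sum.swap)
  also have "\<dots> = (\<Sum>m\<in>?M. chi n * (if int m dvd n then 1 else 0))"
  proof (rule sum.cong[OF refl])
    fix m assume m: "m \<in> ?M"
    show "(\<Sum>r1=1..k. \<Sum>r2=1..k. if int k dvd int m - int r1 then
        if int (k * m) dvd n - int (m * r2) then chi (int (r1 * r2)) else 0 else 0)
        = chi n * (if int m dvd n then 1 else 0)"
    proof (cases "int m dvd n")
      case True
      then obtain j where n: "n = int m * j" by (auto elim: dvdE)
      have "int (k * m) dvd n - int (m * r2) \<longleftrightarrow> int k dvd j - int r2" for r2
        using m by (simp add: n mult.commute[of "int k"] flip: right_diff_distrib)
      then have "(\<Sum>r1=1..k. \<Sum>r2=1..k. if int k dvd int m - int r1 then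
          if int (k * m) dvd n - int (m * r2) then chi (int (r1 * r2)) else 0 else 0)
        = (\<Sum>r1=1..k. if int k dvd int m - int r1 then
            (\<Sum>r2=1..k. if int k dvd j - int r2 then chi (int r1 * int r2) else 0) else 0)"
        by (auto intro!: sum.cong)
      also have "\<dots> = (\<Sum>r1=1..k. if int k dvd int m - int r1 then chi (int r1 * j) else 0)"
      proof (intro sum.cong refl if_cong)
        fix r1
        show "(\<Sum>r2=1..k. if int k dvd j - int r2 then chi (int r1 * int r2) else 0) = chi (int r1 * j)"
          by (rule sum_residues[OF k, of "\<lambda>i. chi (int r1 * i)"])
            (metis per dvd_mult right_diff_distrib)
      qed
      also have "\<dots> = chi (int m * j)"
        by (rule sum_residues[OF k, of "\<lambda>i. chi (i * j)"]) (metis per dvd_mult2 left_diff_distrib)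
      finally show ?thesis using True by (simp add: n)
    next
      case False
      \<comment> \<open>Divisibility by \<open>k * m\<close> would force \<open>m\<close> to divide
        \<open>n\<close>, whatever \<open>r2\<close> is.\<close>
      have "\<not> int (k * m) dvd n - int (m * r2)" for r2
      proof
        assume "int (k * m) dvd n - int (m * r2)"
        then have "int m dvd n - int m * int r2" by (metis dvd_mult_right of_nat_mult)
        then have "int m dvd (n - int m * int r2) + int m * int r2" by (intro dvd_add) auto
        then show False using False by simp
      qed
      then show ?thesis using False by (auto intro!: sum.neutral)
    qed
  qed
  also have "\<dots> = chi n * of_nat (divisors_upto b n)"
    by (simp add: divisors_upto_eq_sum sum_distrib_left)
  finally show ?thesis .
qed

text \<open>The right-hand side of \<open>weighted_progressions\<close> abstracted to its shape, so
  that (III) can be summed over residue pairs in one rewrite.\<close>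

lemma sum_combine:
  fixes c :: "'p \<Rightarrow> complex"
  shows "(\<Sum>p\<in>X. c p * (\<kappa> * g p * J + (\<Sum>r=0..R. z r * h p r) - \<zeta> * v p + e p)) =
    \<kappa> * (\<Sum>p\<in>X. c p * (g p * J)) + (\<Sum>r=0..R. z r * (\<Sum>p\<in>X. c p * h p r))
    - \<zeta> * (\<Sum>p\<in>X. c p * v p) + (\<Sum>p\<in>X. c p * e p)"
proof -
  have "(\<Sum>p\<in>X. \<Sum>r=0..R. c p * (z r * h p r)) = (\<Sum>r=0..R. \<Sum>p\<in>X. z r * (c p * h p r))"
    by (subst sum.swap) (simp add: mult.left_commute)
  then show ?thesis
    by (simp add: sum.distrib sum_subtractf sum_distrib_left distrib_left right_diff_distrib mult_ac)
qed

section \<open>The summation formulas\<close>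

text \<open>The signs can be checked on \<open>f = 1\<close>, \<open>chi = 1\<close>,
  \<open>k = 1\<close>, \<open>R = 0\<close> with nonintegral endpoints: (I) becomes floor b - floor
  a = (b - a) + sawtooth b - sawtooth a, so the boundary sum enters with a plus and the remainder
  with a minus. In (III), each integration by parts of a sawtooth series along modulus
  \<open>k * m\<close> brings a factor \<open>k * m / (2 * pi * \<i> * n)\<close>; this is the
  source of the powers of \<open>m\<close> and of the denominators in the remainder. The condition
  \<open>0 \<le> a\<close> makes every summed \<open>n\<close> positive, and for
  \<open>a = 0\<close> the endpoint correction counts the \<open>m \<le> b\<close> at
  \<open>n = 0\<close>.\<close>

theorem theorem1:
  fixes f :: "real \<Rightarrow> complex" and a b :: real and R k :: nat and chi :: "int \<Rightarrow> complex"
  assumes "a < b"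
    and "cont_derivs_on (R + 1) {a..b} f"
    and "0 < k"
    and "\<And>n. chi (n + int k) = chi n"
  shows
    "((\<forall>r\<le>R. \<forall>x\<in>{a, b}. sym_convergent (\<lambda>n.
          tau k chi (- n) * cis (2 * pi * of_int n * x / of_nat k)
            / (2 * of_real pi * \<i> * of_int n) ^ (r + 1))) \<and>
      sym_convergent (\<lambda>n. tau k chi (- n) / (2 * of_real pi * \<i> * of_int n) ^ (R + 1)
          * integral {a..b} (\<lambda>u. nth_deriv_within {a..b} (R + 1) f u * cis (2 * pi * of_int n * u / of_nat k))) \<and>
      (\<Sum>n | a < of_int n \<and> of_int n \<le> b. chi n * f (of_int n)) =
        1 / of_nat k * (\<Sum>l=1..k. chi (int l)) * integral {a..b} f
        + (\<Sum>r=0..R. (- of_nat k) ^ r *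
            (nth_deriv_within {a..b} r f b * sym_sum (\<lambda>n. tau k chi (- n) * cis (2 * pi * of_int n * b / of_nat k)
                 / (2 * of_real pi * \<i> * of_int n) ^ (r + 1))
           - nth_deriv_within {a..b} r f a * sym_sum (\<lambda>n. tau k chi (- n) * cis (2 * pi * of_int n * a / of_nat k)
                 / (2 * of_real pi * \<i> * of_int n) ^ (r + 1))))
        - (- of_nat k) ^ R *
            sym_sum (\<lambda>n. tau k chi (- n) / (2 * of_real pi * \<i> * of_int n) ^ (R + 1)
              * integral {a..b} (\<lambda>u. nth_deriv_within {a..b} (R + 1) f u * cis (2 * pi * of_int n * u / of_nat k)))
        + end_correction a b (\<lambda>n. chi n * f (of_int n)))
     \<and>
     (0 \<le> a \<longrightarrow>
      (\<forall>r\<le>R. \<forall>x\<in>{a, b}. sym_convergent (\<lambda>n.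
          1 / (2 * of_real pi * \<i> * of_int n) ^ (r + 1)
            * (\<Sum>m::nat | 1 \<le> m \<and> of_nat m \<le> b.
                 of_nat m ^ r * cis (2 * pi * of_int n * x / of_nat m)))) \<and>
      sym_convergent (\<lambda>n. 1 / (2 * of_real pi * \<i> * of_int n) ^ (R + 1)
          * integral {a..b} (\<lambda>u. nth_deriv_within {a..b} (R + 1) f u
            * (\<Sum>m::nat | 1 \<le> m \<and> of_nat m \<le> b.
                 of_nat m ^ R * cis (2 * pi * of_int n * u / of_nat m)))) \<and>
      (\<Sum>n | a < of_int n \<and> of_int n \<le> b. of_nat (divisor_fun n) * f (of_int n)) =
        integral {a..b} f * (\<Sum>m::nat | 1 \<le> m \<and> of_nat m \<le> b. 1 / of_nat m)
        + (\<Sum>r=0..R. (- 1) ^ r *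
            (nth_deriv_within {a..b} r f b * sym_sum (\<lambda>n. 1 / (2 * of_real pi * \<i> * of_int n) ^ (r + 1)
                 * (\<Sum>m::nat | 1 \<le> m \<and> of_nat m \<le> b.
                      of_nat m ^ r * cis (2 * pi * of_int n * b / of_nat m)))
           - nth_deriv_within {a..b} r f a * sym_sum (\<lambda>n. 1 / (2 * of_real pi * \<i> * of_int n) ^ (r + 1)
                 * (\<Sum>m::nat | 1 \<le> m \<and> of_nat m \<le> b.
                      of_nat m ^ r * cis (2 * pi * of_int n * a / of_nat m)))))
        - (- 1) ^ R *
            sym_sum (\<lambda>n. 1 / (2 * of_real pi * \<i> * of_int n) ^ (R + 1)
              * integral {a..b} (\<lambda>u. nth_deriv_within {a..b} (R + 1) f u
                * (\<Sum>m::nat | 1 \<le> m \<and> of_nat m \<le> b.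
                     of_nat m ^ R * cis (2 * pi * of_int n * u / of_nat m))))
        + end_correction a b (\<lambda>n. of_nat (divisors_upto b n) * f (of_int n)))
     \<and>
     (0 \<le> a \<longrightarrow>
      (\<forall>r1\<in>{1..k}. \<forall>r2\<in>{1..k}. \<forall>r\<le>R. \<forall>x\<in>{a, b}. sym_convergent (\<lambda>n.
          cis (- 2 * pi * of_int n * of_nat r2 / of_nat k)
            / (2 * of_real pi * \<i> * of_int n) ^ (r + 1)
            * (\<Sum>m::nat | 1 \<le> m \<and> of_nat m \<le> b \<and> [m = r1] (mod k).
                 of_nat m ^ r * cis (2 * pi * of_int n * x / (of_nat m * of_nat k))))) \<and>
      (\<forall>r1\<in>{1..k}. \<forall>r2\<in>{1..k}. sym_convergent (\<lambda>n.
          cis (- 2 * pi * of_int n * of_nat r2 / of_nat k)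
            / (2 * of_real pi * \<i> * of_int n) ^ (R + 1)
            * integral {a..b} (\<lambda>u. nth_deriv_within {a..b} (R + 1) f u
              * (\<Sum>m::nat | 1 \<le> m \<and> of_nat m \<le> b \<and> [m = r1] (mod k).
                   of_nat m ^ R * cis (2 * pi * of_int n * u / (of_nat m * of_nat k)))))) \<and>
      (\<Sum>n | a < of_int n \<and> of_int n \<le> b. chi n * of_nat (divisor_fun n) * f (of_int n)) =
        1 / of_nat k * (\<Sum>r1=1..k. \<Sum>r2=1..k. chi (int (r1 * r2))
            * (\<Sum>m::nat | 1 \<le> m \<and> of_nat m \<le> b \<and> [m = r1] (mod k).
                 1 / of_nat m * integral {a..b} f))
        + (\<Sum>r=0..R. (- 1) ^ r * of_nat k ^ r *
            (\<Sum>r1=1..k. \<Sum>r2=1..k. chi (int (r1 * r2)) *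
              (nth_deriv_within {a..b} r f b * sym_sum (\<lambda>n. cis (- 2 * pi * of_int n * of_nat r2 / of_nat k)
                   / (2 * of_real pi * \<i> * of_int n) ^ (r + 1)
                   * (\<Sum>m::nat | 1 \<le> m \<and> of_nat m \<le> b \<and> [m = r1] (mod k).
                        of_nat m ^ r * cis (2 * pi * of_int n * b / (of_nat m * of_nat k))))
             - nth_deriv_within {a..b} r f a * sym_sum (\<lambda>n. cis (- 2 * pi * of_int n * of_nat r2 / of_nat k)
                   / (2 * of_real pi * \<i> * of_int n) ^ (r + 1)
                   * (\<Sum>m::nat | 1 \<le> m \<and> of_nat m \<le> b \<and> [m = r1] (mod k).
                        of_nat m ^ r * cis (2 * pi * of_int n * a / (of_nat m * of_nat k)))))))
        - (- of_nat k) ^ R *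
            (\<Sum>r1=1..k. \<Sum>r2=1..k. chi (int (r1 * r2)) *
              sym_sum (\<lambda>n. cis (- 2 * pi * of_int n * of_nat r2 / of_nat k)
                / (2 * of_real pi * \<i> * of_int n) ^ (R + 1)
                * integral {a..b} (\<lambda>u. nth_deriv_within {a..b} (R + 1) f u
                  * (\<Sum>m::nat | 1 \<le> m \<and> of_nat m \<le> b \<and> [m = r1] (mod k).
                       of_nat m ^ R * cis (2 * pi * of_int n * u / (of_nat m * of_nat k))))))
        + end_correction a b (\<lambda>n. chi n * of_nat (divisors_upto b n) * f (of_int n)))"
proof -
  note ab = assms(1) and cd = assms(2) and k = assms(3)
  define M where "M = {m::nat. 1 \<le> m \<and> of_nat m \<le> b}"
  define M' where "M' = (\<lambda>r1. {m::nat. 1 \<le> m \<and> of_nat m \<le> b \<and> [m = r1] (mod k)})"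
  have fin: "finite M" "finite (M' r1)" for r1
    using finite_nat_le_real[of b "\<lambda>_. True"] finite_nat_le_real by (simp_all add: M_def M'_def)
  have per: "chi m = chi n" if "int k dvd m - n" for m n
  proof -
    \<comment> \<open>Extends the shift by \<open>k\<close> to all integer multiples of
      \<open>k\<close>, negative ones included.\<close>
    interpret periodic_fun_simple chi "int k" by unfold_locales (rule assms(4))
    from that obtain t where "m - n = int k * t" by (elim dvdE)
    then have "m = n + of_int t * int k" by (simp add: algebra_simps)
    then show ?thesis by (simp only: plus_of_int)
  qed
  have pull: "integral {a..b} (\<lambda>u. F u * (c * h u)) = c * integral {a..b} (\<lambda>u. F u * h u)"
    for c :: complex and F h
    by (simp add: mult.left_commute)
  have divisor_sum: "(\<Sum>n | a < of_int n \<and> of_int n \<le> b. g n * of_nat (divisors_upto b n) * f (of_int n))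
      = (\<Sum>n | a < of_int n \<and> of_int n \<le> b. g n * of_nat (divisor_fun n) * f (of_int n))"
    if "0 \<le> a" for g :: "int \<Rightarrow> complex"
    using that by (intro sum.cong refl) (auto simp: divisors_upto_eq_divisor_fun)

  \<comment> \<open>(I) has index \<open>l\<close>, modulus \<open>k\<close>, shift \<open>l\<close>
    and weight \<open>chi l\<close>. The shift produces the argument \<open>- n\<close> of
    \<open>tau\<close>, and the power of 1 is a dummy to fit the general form.\<close>
  have HI: "tau k chi (- n) * cis (2 * pi * of_int n * x / of_nat k) =
      (\<Sum>l=1..k. chi (int l) * of_nat 1 ^ r * cis (2 * pi * of_int n * ((x - of_int (int l)) / of_nat (k * 1))))"
    for r x n
    unfolding tau_def sum_distrib_right
  proof (intro sum.cong refl)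
    fix l
    have "2 * pi * of_int n * ((x - of_int (int l)) / of_nat (k * 1)) =
        2 * pi * of_int (- n) * of_nat l / of_nat k + 2 * pi * of_int n * x / of_nat k"
      by (simp add: diff_divide_distrib right_diff_distrib)
    then show "chi (int l) * cis (2 * pi * of_int (- n) * of_nat l / of_nat k) * cis (2 * pi * of_int n * x / of_nat k)
        = chi (int l) * of_nat 1 ^ r * cis (2 * pi * of_int n * ((x - of_int (int l)) / of_nat (k * 1)))"
      by (simp only: cis_mult[symmetric]) simp
  qed
  have WI: "chi n = (\<Sum>l=1..k. if int (k * 1) dvd n - int l then chi (int l) else 0)" for n
    using sum_residues[OF k, of chi n] per by simp
  note I = weighted_progressions[OF ab cd k finite_atLeastAtMost ballI[OF zero_less_one] HI WI]
  have remI: "(\<lambda>n. tau k chi (- n) / (2 * of_real pi * \<i> * of_int n) ^ (R + 1)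
          * integral {a..b} (\<lambda>u. nth_deriv_within {a..b} (R + 1) f u * cis (2 * pi * of_int n * u / of_nat k)))
      = (\<lambda>n. integral {a..b} (\<lambda>u. nth_deriv_within {a..b} (R + 1) f u *
          (tau k chi (- n) * cis (2 * pi * of_int n * u / of_nat k))) / (2 * of_real pi * \<i> * of_int n) ^ (R + 1))"
    unfolding pull by simp

  \<comment> \<open>(II) has outer factor 1, and for each \<open>m \<le> b\<close> the progression
    of multiples of \<open>m\<close> with unit weight.\<close>
  have HII: "(\<Sum>m\<in>M. of_nat m ^ r * cis (2 * pi * of_int n * x / of_nat m)) =
      (\<Sum>m\<in>M. 1 * of_nat m ^ r * cis (2 * pi * of_int n * ((x - of_int 0) / of_nat (1 * m))))"
    for r x n
    by simp
  have WII: "of_nat (divisors_upto b n) = (\<Sum>m\<in>M. if int (1 * m) dvd n - 0 then 1 else 0 :: complex)" for n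
    unfolding divisors_upto_eq_sum M_def by simp
  have M_pos: "\<forall>m\<in>M. 0 < m" by (simp add: M_def)
  note II = weighted_progressions[OF ab cd zero_less_one fin(1) M_pos HII WII]
  have mult_II: "1 / c * z = z / c" for c z :: complex by simp

  \<comment> \<open>In (III) each pair of residues is a separate instance, with unit weights,
    modulus \<open>k * m\<close> and shift \<open>m * r2\<close>, because convergence is claimed
    pair by pair; the weights \<open>chi (r1 * r2)\<close> are applied afterwards.\<close>
  let ?H = "\<lambda>r1 r2 r x n. cis (- 2 * pi * of_int n * of_nat r2 / of_nat k) *
      (\<Sum>m\<in>M' r1. of_nat m ^ r * cis (2 * pi * of_int n * x / (of_nat m * of_nat k)))"
  let ?W = "\<lambda>r1 r2 n. \<Sum>m\<in>M' r1. if int (k * m) dvd n - int (m * r2) then 1 else 0 :: complex"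
  have M'_pos: "\<forall>m\<in>M' r1. 0 < m" for r1 by (simp add: M'_def)
  have HIII: "?H r1 r2 r x n = (\<Sum>m\<in>M' r1. 1 * of_nat m ^ r *
      cis (2 * pi * of_int n * ((x - of_int (int (m * r2))) / of_nat (k * m))))"
    for r x n r1 r2
    unfolding sum_distrib_left
  proof (intro sum.cong refl)
    fix m assume m: "m \<in> M' r1"
    have "2 * pi * of_int n * ((x - of_int (int (m * r2))) / of_nat (k * m)) =
        - 2 * pi * of_int n * of_nat r2 / of_nat k + 2 * pi * of_int n * x / (of_nat m * of_nat k)"
      using M'_pos m k by (simp add: field_simps)
    then show "cis (- 2 * pi * of_int n * of_nat r2 / of_nat k) *
        (of_nat m ^ r * cis (2 * pi * of_int n * x / (of_nat m * of_nat k))) =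
        1 * of_nat m ^ r * cis (2 * pi * of_int n * ((x - of_int (int (m * r2))) / of_nat (k * m)))"
      by (simp only: cis_mult[symmetric]) simp
  qed
  note III = weighted_progressions[OF ab cd k fin(2) M'_pos HIII refl]
  have WIII: "chi n * of_nat (divisors_upto b n) =
      (\<Sum>r1=1..k. \<Sum>r2=1..k. chi (int (r1 * r2)) * ?W r1 r2 n)" for n
    unfolding M'_def using sum_residue_pairs_eq_divisors[OF k, of chi n b] per by simp
  have mult_III: "z / c ^ p * s = (z * s) / c ^ p" for c z s :: complex and p :: nat by simp

  have M'_eq: "{m::nat. 1 \<le> m \<and> of_nat m \<le> b \<and> [m = r1] (mod k)} = M' r1" for r1
    by (simp add: M'_def)

  show ?thesis
    unfolding M_def[symmetric] M'_eq
  proof (intro conjI impI, goal_cases)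
    case 1 show ?case using I(1) by blast
  next
    case 2 show ?case unfolding remI by (rule I(2))
  next
    case 3 show ?case unfolding remI using I(3) by simp
  next
    case 4 show ?case unfolding mult_II using II(1) by blast
  next
    case 5 show ?case unfolding mult_II by (rule II(2))
  next
    case 6 show ?case
      unfolding mult_II using II(3) divisor_sum[OF 6, of "\<lambda>_. 1"]
      by (simp add: mult.commute)
  next
    case 7 show ?case unfolding mult_III using III(1) by blast
  next
    case 8 show ?case unfolding mult_III unfolding pull[symmetric] using III(2) by blast
  next
    case 9
    \<comment> \<open>Pairs of residues become a single index, so that \<open>sum_combine\<close>
      and \<open>end_correction_sum\<close> apply once.\<close>
    let ?X = "{1..k} \<times> {1..k}"
    have harm: "(\<Sum>m\<in>A. 1 / of_nat m * J) = (\<Sum>m\<in>A. 1 / of_nat m) * J" for A and J :: complex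
      by (simp add: sum_distrib_right)
    let ?S = "\<lambda>p. \<Sum>n | a < of_int n \<and> of_int n \<le> b. ?W (fst p) (snd p) n * f (of_int n)"
    have Wf: "chi n * of_nat (divisors_upto b n) * f (of_int n) =
        (\<Sum>p\<in>?X. chi (int (fst p * snd p)) * (?W (fst p) (snd p) n * f (of_int n)))" for n
      unfolding WIII by (simp add: sum.cartesian_product sum_distrib_right case_prod_unfold mult.assoc)
    have "(\<Sum>n | a < of_int n \<and> of_int n \<le> b. chi n * of_nat (divisor_fun n) * f (of_int n)) =
        (\<Sum>p\<in>?X. chi (int (fst p * snd p)) * ?S p)"
      unfolding divisor_sum[OF 9, symmetric] Wf by (subst sum.swap) (simp add: sum_distrib_left)
    then show ?case
      unfolding mult_III
      unfolding pull[symmetric] III(3) sum_combine Wf end_correction_sum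
        sum.cartesian_product case_prod_unfold power_minus[of "of_nat k"] harm
      by (simp only: mult_1_right)
  qed
qed

end
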